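(* Let $\mathbf{H}_n^{\mathrm{indep}}(\beta)=\sum_{i=1}^n \mathbf{X}_i^T\mathbf{A}_i(\beta)\mathbf{X}_i$. Suppose that for every $\beta\in\mathcal{T}$: (1) there exists a constant $C_\beta>0$ such that $\lambda_{\min}[\overline{\mathbf{R}}_n^{(c)}(\beta)]\ge C_\beta$ for all $n\ge 1$, $P_\beta$-almost surely; (2) $\lambda_{\min}[\mathbf{H}_n^{\mathrm{indep}}(\beta)]\to\infty$ as $n\to\infty$. Let $\{\mathcal{R}_n^*(\beta)\}_{n}$ be a sequence of random $m\times m$ matrices such that $\mathcal{R}_n^*(\beta)$ is positive definite and continuously differentiable in $\beta$, the entries of $\mathcal{R}_n^*(\beta)$ are $\mathcal{F}_n$-measurable, and, for every $\beta\in\mathcal{T}$: (3) $\mathcal{R}_{n-1}^*(\beta)-\overline{\mathbf{R}}_n^{(c)}(\beta)\to 0$ element-wise, in $P_\beta$-probability, as $n\to\infty$; (4) there exists a constant $K_\beta>0$ such that $\lambda_{\min}[\mathcal{R}_n^*(\beta)]\ge K_\beta$ for all $n\ge 1$, $P_\beta$-almost surely. Define $$\mathbf{g}_n^*(\beta)=\sum_{i=1}^n \mathbf{X}_i^T\mathbf{A}_i(\beta)^{1/2}\mathcal{R}_{i-1}^*(\beta)^{-1}\mathbf{A}_i(\beta)^{-1/2}(\mathbf{y}_i-\mu_i(\beta)).$$ Then the sequence $\{\mathbf{g}_n^*(\beta)\}_{n\ge1}$ is asymptotically optimal (an asymptotic quasi-score) within the collection $\{\mathcal{H}_n\}_{n\ge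 1}$.
   Context: Model. $m,p\ge1$ are fixed integers, $\mathcal{T}\subset\mathbb{R}^p$ is open, and $\mathbf{y}_i=(y_{i1},\dots,y_{im})^T$, $i\ge1$, are random vectors on a measurable space $(\Omega,\mathcal{F})$ carrying a family of probability measures $\{P_\beta:\beta\in\mathcal{T}\}$. $\mathcal{F}_i$ is the $\sigma$-field generated by $\mathbf{y}_1,\dots,\mathbf{y}_i$ ($\mathcal{F}_0$ trivial). $E_\beta,\mathrm{Var}_\beta,\mathrm{Cov}_\beta$ refer to $P_\beta$. The covariates $\mathbf{x}_{ij}\in\mathbb{R}^p$ are non-random, $\mathbf{X}_i=(\mathbf{x}_{i1},\dots,\mathbf{x}_{im})^T$ ($m\times p$). The link $\mu:\mathbb{R}\to\mathbb{R}$ is differentiable with positive derivative. For all $\beta\in\mathcal{T}$, $i\ge1$, $1\le j\le m$: $$E_\beta(y_{ij}\mid\mathcal{F}_{i-1})=\mu(\mathbf{x}_{ij}^T\beta)=:\mu_{ij}(\beta),\qquad \mathrm{Var}_\beta(y_{ij}\mid\mathcal{F}_{i-1})=\mu'(\mathbf{x}_{ij}^T\beta)=:\sigma_{ij}^2(\beta).$$ Put $\mu_i(\beta)=(\mu_{i1}(\beta),\dots,\mu_{im}(\beta))^T$, $\mathbf{A}_i(\beta)=\mathrm{diag}(\sigma^2_{i1}(\beta),\dots,\sigma^2_{im}(\beta))$. The conditional covariance matrix is $\Sigma_i^{(c)}(\beta)=E_\beta[(\mathbf{y}_i-\mu_i(\beta))(\mathbf{y}_i-\mu_i(\beta))^T\mid\mathcal{F}_{i-1}]$,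 with entries $v^{(c)}_{i,jk}(\beta)$, and the conditional correlation matrix is $\overline{\mathbf{R}}_i^{(c)}(\beta)=\mathbf{A}_i(\beta)^{-1/2}\Sigma_i^{(c)}(\beta)\mathbf{A}_i(\beta)^{-1/2}$. $\lambda_{\min}$ denotes the smallest eigenvalue of a symmetric matrix; positive definite matrices are symmetric; square roots are symmetric square roots. The sequence $\{\mathcal{R}^*_n(\beta)\}$ is indexed by $n\ge0$ (so $\mathcal{R}^*_0(\beta)$ is non-random and positive definite). Class of estimating functions. $\mathcal{H}_n$ is the set of functions $\mathbf{q}_n(\beta)=\sum_{i=1}^n\mathbf{C}_i(\beta)(\mathbf{y}_i-\mu_i(\beta))$, $\beta\in\mathcal{T}$, where each $\mathbf{C}_i(\beta)$ is a $p\times m$ random matrix whose entries $c_{i,uj}(\beta)$ are $\mathcal{F}_{i-1}$-measurable and continuously differentiable in $\beta$, and for all $\beta\in\mathcal{T}$, $i\ge 1$, $1\le u,v\le p$, $1\le j,k\le m$ the expectations $E_\beta|c_{i,uj}(\beta)|$, $E_\beta\big[\frac{\partial c_{i,uj}(\beta)}{\partial\beta_v}(y_{ij}-\mu_{ij}(\beta))\big]$, $E_\beta[c_{i,uj}(\beta)v^{(c)}_{i,jk}(\beta)c_{i,vk}(\beta)]$ exist and are finite. For $\mathbf{q}_n\in\mathcal{H}_n$ define $$\mathcal{E}[\mathbf{q}_n(\beta)]=\Big\{E_\beta\Big[\frac{\partial\mathbf{q}_n(\beta)}{\partial\beta^T}\Big]\Big\}^T\{\mathrm{Cov}_\beta[\mathbf{q}_n(\beta)]\}^{-1}E_\beta\Big[\frac{\partial\mathbf{q}_n(\beta)}{\partial\beta^T}\Big],\qquad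 \mathcal{I}[\mathbf{q}_n(\beta)]=\{\mathcal{E}[\mathbf{q}_n(\beta)]\}^{-1}.$$ Definition (asymptotically optimal / asymptotic quasi-score). A sequence $\{\mathbf{q}_n^*(\beta)\}_{n\ge1}$ with $\mathbf{q}_n^*\in\mathcal{H}_n$ is asymptotically optimal within $\{\mathcal{H}_n\}_{n\ge1}$ if for any sequence $\{\mathbf{q}_n(\beta)\}_{n\ge1}$ with $\mathbf{q}_n\in\mathcal{H}_n$ for all $n$, for any $\beta\in\mathcal{T}$ and any $\lambda\in\mathbb{R}^p$ with $\|\lambda\|=1$, $$\liminf_{n\to\infty}\lambda^T\big[\mathcal{I}_n^*(\beta)^{-1/2}\,\mathcal{I}_n(\beta)\,\mathcal{I}_n^*(\beta)^{-1/2}-\mathbf{I}\big]\lambda\ge0,$$ where $\mathcal{I}_n^*(\beta)=\mathcal{I}[\mathbf{q}_n^*(\beta)]$ and $\mathcal{I}_n(\beta)=\mathcal{I}[\mathbf{q}_n(\beta)]$. Competing sequences are those for which $\mathcal{I}[\mathbf{q}_n(\beta)]$ is defined (the matrices being inverted are nonsingular) for all sufficiently large $n$. Standing assumption: the functions $\mathbf{g}_n^*(\beta)$ and $\overline{\mathbf{g}}_n(\beta)=\sum_{i=1}^n\mathbf{X}_i^T\mathbf{A}_i(\beta)^{1/2}\overline{\mathbf{R}}_i^{(c)}(\beta)^{-1}\mathbf{A}_i(\beta)^{-1/2}(\mathbf{y}_i-\mu_i(\beta))$ belong to $\mathcal{H}_n$ for every $n$. *)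

theory Defs
  imports "HOL-Probability.Probability"
begin

section \<open>Symmetric matrices\<close>

definition symmetric_mat :: "real^'n^'n \<Rightarrow> bool" where
  "symmetric_mat A \<longleftrightarrow> transpose A = A"

definition pos_semidef_mat :: "real^'n^'n \<Rightarrow> bool" where
  "pos_semidef_mat A \<longleftrightarrow> symmetric_mat A \<and> (\<forall>v. 0 \<le> v \<bullet> (A *v v))"

definition pos_def_mat :: "real^'n^'n \<Rightarrow> bool" where
  "pos_def_mat A \<longleftrightarrow> symmetric_mat A \<and> (\<forall>v. v \<noteq> 0 \<longrightarrow> 0 < v \<bullet> (A *v v))"

text \<open>The set of real eigenvalues is always finite, and it is nonempty for a symmetric matrix;
  on other matrices the value is not meaningful.\<close>

definition lambda_min :: "real^'n^'n \<Rightarrow> real" where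
  "lambda_min A = Min {c. \<exists>v. v \<noteq> 0 \<and> A *v v = c *\<^sub>R v}"

text \<open>The symmetric positive semidefinite square root, which exists and is unique when \<open>A\<close> is
  symmetric positive semidefinite. The power \<open>-1/2\<close> is rendered as its inverse.\<close>

definition mat_sqrt :: "real^'n^'n \<Rightarrow> real^'n^'n" where
  "mat_sqrt A = (THE B. pos_semidef_mat B \<and> B ** B = A)"

definition mat_inv_sqrt :: "real^'n^'n \<Rightarrow> real^'n^'n" where
  "mat_inv_sqrt A = matrix_inv (mat_sqrt A)"


section \<open>Calculus and probability\<close>

definition cont_differentiable_on ::
    "('a::real_normed_vector \<Rightarrow> 'b::real_normed_vector) \<Rightarrow> 'a set \<Rightarrow> bool" where
  "cont_differentiable_on f T \<longleftrightarrow>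
     (\<exists>f'. (\<forall>b\<in>T. (f has_derivative blinfun_apply (f' b)) (at b)) \<and> continuous_on T f')"

definition partial_deriv :: "'p \<Rightarrow> (real^'p \<Rightarrow> real) \<Rightarrow> real^'p \<Rightarrow> real" where
  "partial_deriv v f b = frechet_derivative f (at b) (axis v 1)"

definition to_zero_in_prob :: "'w measure \<Rightarrow> (nat \<Rightarrow> 'w \<Rightarrow> real) \<Rightarrow> bool" where
  "to_zero_in_prob Q Z \<longleftrightarrow>
     (\<forall>e>0. (\<lambda>n. measure Q {w \<in> space Q. e < \<bar>Z n w\<bar>}) \<longlonglongrightarrow> 0)"

definition cond_var :: "'w measure \<Rightarrow> 'w measure \<Rightarrow> ('w \<Rightarrow> real) \<Rightarrow> 'w \<Rightarrow> real" where
  "cond_var Q F f = real_cond_exp Q F (\<lambda>w. (f w - real_cond_exp Q F f w)\<^sup>2)"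

definition cov_mat :: "'w measure \<Rightarrow> ('w \<Rightarrow> real^'p) \<Rightarrow> real^'p^'p" where
  "cov_mat Q f = (\<chi> u v. \<integral>w. (f w $ u - (\<integral>w'. f w' $ u \<partial>Q)) * (f w $ v - (\<integral>w'. f w' $ v \<partial>Q)) \<partial>Q)"


section \<open>The longitudinal model\<close>

text \<open>Conventions. \<open>M\<close> carries only the measurable space (its measure is never used) and
  \<open>P \<beta>\<close> are the probability measures on it. Individuals are numbered from 1, so \<open>y 0\<close> and
  \<open>X 0\<close> are never used. \<open>X i\<close> is the matrix with rows \<open>X i $ j\<close>, the covariates of the
  \<open>j\<close>-th measurement on individual \<open>i\<close>.\<close>

definition past :: "'w measure \<Rightarrow> (nat \<Rightarrow> 'w \<Rightarrow> real^'m) \<Rightarrow> nat \<Rightarrow> 'w measure" where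
  "past M y i = sigma (space M) (\<Union>k\<in>{1..i}. {y k -` B \<inter> space M | B. B \<in> sets borel})"

definition mu_vec ::
    "(nat \<Rightarrow> real^'p^'m) \<Rightarrow> (real \<Rightarrow> real) \<Rightarrow> nat \<Rightarrow> real^'p \<Rightarrow> real^'m" where
  "mu_vec X mu i b = (\<chi> j. mu (X i $ j \<bullet> b))"

definition sigma2 ::
    "(nat \<Rightarrow> real^'p^'m) \<Rightarrow> (real \<Rightarrow> real) \<Rightarrow> nat \<Rightarrow> real^'p \<Rightarrow> real^'m" where
  "sigma2 X mu i b = (\<chi> j. deriv mu (X i $ j \<bullet> b))"

definition A_mat ::
    "(nat \<Rightarrow> real^'p^'m) \<Rightarrow> (real \<Rightarrow> real) \<Rightarrow> nat \<Rightarrow> real^'p \<Rightarrow> real^'m^'m" where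
  "A_mat X mu i b = (\<chi> j k. if j = k then sigma2 X mu i b $ j else 0)"

definition resid ::
    "(nat \<Rightarrow> 'w \<Rightarrow> real^'m) \<Rightarrow> (nat \<Rightarrow> real^'p^'m) \<Rightarrow> (real \<Rightarrow> real) \<Rightarrow> nat \<Rightarrow> real^'p \<Rightarrow> 'w \<Rightarrow> real^'m" where
  "resid y X mu i b w = y i w - mu_vec X mu i b"

text \<open>The conditional covariance matrices are determined only up to \<open>P \<beta>\<close>-null sets. \<open>Sc\<close> is an
  arbitrary choice of versions; a choice is needed because estimating functions built from it have
  to be smooth in \<open>\<beta>\<close> for each outcome.\<close>

locale longitudinal_model =
  fixes M :: "'w measure"
    and P :: "real^'p \<Rightarrow> 'w measure"
    and T :: "(real^'p) set"
    and y :: "nat \<Rightarrow> 'w \<Rightarrow> real^'m"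
    and X :: "nat \<Rightarrow> real^'p^'m"
    and mu :: "real \<Rightarrow> real"
    and Sc :: "nat \<Rightarrow> real^'p \<Rightarrow> 'w \<Rightarrow> real^'m^'m"
  assumes open_T: "open T"
    and prob_P: "\<And>b. b \<in> T \<Longrightarrow> prob_space (P b)"
    and space_P: "\<And>b. b \<in> T \<Longrightarrow> space (P b) = space M"
    and sets_P: "\<And>b. b \<in> T \<Longrightarrow> sets (P b) = sets M"
    and y_measurable: "\<And>i. 1 \<le> i \<Longrightarrow> y i \<in> borel_measurable M"
    and mu_differentiable: "\<And>t. mu differentiable (at t)"
    and mu_deriv_pos: "\<And>t. 0 < deriv mu t"
    and y_integrable: "\<And>b i j. b \<in> T \<Longrightarrow> 1 \<le> i \<Longrightarrow> integrable (P b) (\<lambda>w. y i w $ j)"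
    and y_sq_integrable: "\<And>b i j. b \<in> T \<Longrightarrow> 1 \<le> i \<Longrightarrow> integrable (P b) (\<lambda>w. (y i w $ j)\<^sup>2)"
    and cond_mean: "\<And>b i j. b \<in> T \<Longrightarrow> 1 \<le> i \<Longrightarrow>
          AE w in P b. real_cond_exp (P b) (past M y (i - 1)) (\<lambda>w. y i w $ j) w = mu_vec X mu i b $ j"
    and cond_variance: "\<And>b i j. b \<in> T \<Longrightarrow> 1 \<le> i \<Longrightarrow>
          AE w in P b. cond_var (P b) (past M y (i - 1)) (\<lambda>w. y i w $ j) w = sigma2 X mu i b $ j"
    and Sc_measurable: "\<And>b i j k. b \<in> T \<Longrightarrow> 1 \<le> i \<Longrightarrow>
          (\<lambda>w. Sc i b w $ j $ k) \<in> borel_measurable (past M y (i - 1))"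
    and Sc_version: "\<And>b i j k. b \<in> T \<Longrightarrow> 1 \<le> i \<Longrightarrow>
          AE w in P b. Sc i b w $ j $ k =
            real_cond_exp (P b) (past M y (i - 1))
              (\<lambda>w. resid y X mu i b w $ j * resid y X mu i b w $ k) w"

definition cond_corr ::
    "(nat \<Rightarrow> real^'p^'m) \<Rightarrow> (real \<Rightarrow> real) \<Rightarrow> (nat \<Rightarrow> real^'p \<Rightarrow> 'w \<Rightarrow> real^'m^'m) \<Rightarrow>
      nat \<Rightarrow> real^'p \<Rightarrow> 'w \<Rightarrow> real^'m^'m" where
  "cond_corr X mu Sc i b w =
     mat_inv_sqrt (A_mat X mu i b) ** Sc i b w ** mat_inv_sqrt (A_mat X mu i b)"

definition H_indep ::
    "(nat \<Rightarrow> real^'p^'m) \<Rightarrow> (real \<Rightarrow> real) \<Rightarrow> nat \<Rightarrow> real^'p \<Rightarrow> real^'p^'p" where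
  "H_indep X mu n b = (\<Sum>i=1..n. transpose (X i) ** A_mat X mu i b ** X i)"

text \<open>The estimating function with working correlation matrix \<open>R i\<close> for individual \<open>i\<close>.\<close>

definition gee ::
    "(nat \<Rightarrow> 'w \<Rightarrow> real^'m) \<Rightarrow> (nat \<Rightarrow> real^'p^'m) \<Rightarrow> (real \<Rightarrow> real) \<Rightarrow>
      (nat \<Rightarrow> real^'p \<Rightarrow> 'w \<Rightarrow> real^'m^'m) \<Rightarrow> nat \<Rightarrow> real^'p \<Rightarrow> 'w \<Rightarrow> real^'p" where
  "gee y X mu R n b w =
     (\<Sum>i=1..n. (transpose (X i) ** mat_sqrt (A_mat X mu i b) ** matrix_inv (R i b w)
                  ** mat_inv_sqrt (A_mat X mu i b)) *v resid y X mu i b w)"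


section \<open>Estimating functions and asymptotic optimality\<close>

definition H_class ::
    "'w measure \<Rightarrow> (real^'p \<Rightarrow> 'w measure) \<Rightarrow> (real^'p) set \<Rightarrow> (nat \<Rightarrow> 'w \<Rightarrow> real^'m) \<Rightarrow>
      (nat \<Rightarrow> real^'p^'m) \<Rightarrow> (real \<Rightarrow> real) \<Rightarrow> (nat \<Rightarrow> real^'p \<Rightarrow> 'w \<Rightarrow> real^'m^'m) \<Rightarrow>
      nat \<Rightarrow> (real^'p \<Rightarrow> 'w \<Rightarrow> real^'p) set" where
  "H_class M P T y X mu Sc n = {q. \<exists>C :: nat \<Rightarrow> real^'p \<Rightarrow> 'w \<Rightarrow> real^'m^'p.
     (\<forall>b\<in>T. \<forall>w\<in>space M. q b w = (\<Sum>i=1..n. C i b w *v resid y X mu i b w)) \<and>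
     (\<forall>i\<in>{1..n}. \<forall>u j.
        (\<forall>b\<in>T. (\<lambda>w. C i b w $ u $ j) \<in> borel_measurable (past M y (i - 1))) \<and>
        (\<forall>w\<in>space M. cont_differentiable_on (\<lambda>b. C i b w $ u $ j) T)) \<and>
     (\<forall>b\<in>T. \<forall>i\<in>{1..n}. \<forall>u v j k.
        integrable (P b) (\<lambda>w. C i b w $ u $ j) \<and>
        integrable (P b) (\<lambda>w. partial_deriv v (\<lambda>b. C i b w $ u $ j) b * resid y X mu i b w $ j) \<and>
        integrable (P b) (\<lambda>w. C i b w $ u $ j * Sc i b w $ j $ k * C i b w $ v $ k))}"

definition exp_jacobian ::
    "(real^'p \<Rightarrow> 'w measure) \<Rightarrow> (real^'p \<Rightarrow> 'w \<Rightarrow> real^'p) \<Rightarrow> real^'p \<Rightarrow> real^'p^'p" where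
  "exp_jacobian P q b = (\<chi> u v. \<integral>w. jacobian (\<lambda>b. q b w) (at b) $ u $ v \<partial>P b)"

definition eff_mat ::
    "(real^'p \<Rightarrow> 'w measure) \<Rightarrow> (real^'p \<Rightarrow> 'w \<Rightarrow> real^'p) \<Rightarrow> real^'p \<Rightarrow> real^'p^'p" where
  "eff_mat P q b =
     transpose (exp_jacobian P q b) ** matrix_inv (cov_mat (P b) (q b)) ** exp_jacobian P q b"

definition info_mat ::
    "(real^'p \<Rightarrow> 'w measure) \<Rightarrow> (real^'p \<Rightarrow> 'w \<Rightarrow> real^'p) \<Rightarrow> real^'p \<Rightarrow> real^'p^'p" where
  "info_mat P q b = matrix_inv (eff_mat P q b)"

definition info_defined ::
    "(real^'p \<Rightarrow> 'w measure) \<Rightarrow> (real^'p \<Rightarrow> 'w \<Rightarrow> real^'p) \<Rightarrow> real^'p \<Rightarrow> bool" where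
  "info_defined P q b \<longleftrightarrow> invertible (cov_mat (P b) (q b)) \<and> invertible (eff_mat P q b)"

text \<open>Competitors are the sequences whose information matrix at the parameter under consideration
  is eventually defined. The same is required of the optimal sequence itself, since otherwise the
  limit inferior would be taken over meaningless inverses. Sequences are indexed from 1.\<close>

definition asymptotically_optimal ::
    "'w measure \<Rightarrow> (real^'p \<Rightarrow> 'w measure) \<Rightarrow> (real^'p) set \<Rightarrow> (nat \<Rightarrow> 'w \<Rightarrow> real^'m) \<Rightarrow>
      (nat \<Rightarrow> real^'p^'m) \<Rightarrow> (real \<Rightarrow> real) \<Rightarrow> (nat \<Rightarrow> real^'p \<Rightarrow> 'w \<Rightarrow> real^'m^'m) \<Rightarrow>
      (nat \<Rightarrow> real^'p \<Rightarrow> 'w \<Rightarrow> real^'p) \<Rightarrow> bool" where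
  "asymptotically_optimal M P T y X mu Sc qs \<longleftrightarrow>
     (\<forall>n\<ge>1. qs n \<in> H_class M P T y X mu Sc n) \<and>
     (\<forall>b\<in>T. \<forall>\<^sub>F n in sequentially. info_defined P (qs n) b) \<and>
     (\<forall>q. (\<forall>n\<ge>1. q n \<in> H_class M P T y X mu Sc n) \<longrightarrow>
        (\<forall>b\<in>T. (\<forall>\<^sub>F n in sequentially. info_defined P (q n) b) \<longrightarrow>
          (\<forall>l. norm l = 1 \<longrightarrow>
            0 \<le> Liminf sequentially (\<lambda>n. ereal (l \<bullet>
                  ((mat_inv_sqrt (info_mat P (qs n) b) ** info_mat P (q n) b
                      ** mat_inv_sqrt (info_mat P (qs n) b) - mat 1) *v l))))))"

end

theory Submission
  imports Defs
begin

text \<open>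
  Fix \<open>\<beta>\<close>. The residuals are martingale differences, so \<open>c \<mapsto> \<Sum>i c\<^sub>i \<bullet> (y\<^sub>i - \<mu>\<^sub>i)\<close> maps predictable
  coefficients into \<open>L\<^sup>2(P\<^sub>\<beta>)\<close> and turns the inner product into
  \<open>\<Sum>i E[c\<^sub>i \<bullet> \<Sigma>\<^sub>i d\<^sub>i]\<close>, where \<open>\<Sigma>\<^sub>i\<close> is the conditional covariance. For every \<open>q\<close> in
  \<open>\<H>\<^sub>n\<close> the expected Jacobian equals \<open>-E[q g\<^sup>T]\<close>, where \<open>g\<close> is the ideal score built from the
  true conditional correlations. So \<open>\<E>[q]\<close> is the Gram matrix of the projection of \<open>g\<close> on the span
  of the components of \<open>q\<close>, whence \<open>\<E>[q] \<le> Cov[g]\<close>.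

  For the score \<open>g\<^sup>*\<close> with working correlations, the projection is no worse an approximation of
  \<open>l \<bullet> g\<close> than \<open>l \<bullet> g\<^sup>*\<close> itself, so \<open>\<E>[g\<^sup>*] \<ge> Cov[g] - Cov[g - g\<^sup>*]\<close>. In direction \<open>l\<close> the error is
  at most \<open>\<Sum>i |A\<^sub>i\<^sup>1\<^sup>/\<^sup>2 X\<^sub>i l|\<^sup>2 \<delta>\<^sub>i\<close>, where \<open>\<delta>\<^sub>i \<rightarrow> 0\<close> by bounded convergence in probability,
  while \<open>Cov[g]\<close> is at least \<open>m\<^sup>-\<^sup>1\<close> times the diverging information \<open>\<Sum>i |A\<^sub>i\<^sup>1\<^sup>/\<^sup>2 X\<^sub>i l|\<^sup>2\<close>. Hence
  \<open>\<E>[g\<^sup>*] \<ge> (1 - \<epsilon>) Cov[g] \<ge> (1 - \<epsilon>) \<E>[q]\<close> for all large \<open>n\<close>.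
\<close>

section \<open>Symmetric matrices\<close>

lemma symmetric_mat_inner:
  fixes A :: "real^'n^'n"
  assumes "symmetric_mat A"
  shows "(A *v v) \<bullet> w = v \<bullet> (A *v w)"
  using assms by (metis dot_lmul_matrix symmetric_mat_def transpose_matrix_vector)

lemma symmetric_matI:
  fixes A :: "real^'n^'n"
  assumes "\<And>v w. (A *v v) \<bullet> w = v \<bullet> (A *v w)"
  shows "symmetric_mat A"
proof -
  have "(transpose A *v w) \<bullet> v = (A *v w) \<bullet> v" for v w
    by (metis assms dot_lmul_matrix inner_commute transpose_matrix_vector)
  then have "transpose A *v w = A *v w" for w
    by (metis vector_eq_rdot)
  then show ?thesis
    by (simp add: symmetric_mat_def matrix_eq)
qed

text \<open>The first-order condition at a minimum: a parabola through the origin that never becomes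
  negative has no slope there. It replaces calculus in the variational arguments below.\<close>

lemma linear_coeff_eq_0:
  fixes a k :: real
  assumes "\<And>t. 0 \<le> 2 * t * a + t\<^sup>2 * k" and "0 \<le> k"
  shows "a = 0"
proof (rule ccontr)
  assume "a \<noteq> 0"
  \<comment> \<open>With \<open>k + 1\<close> in place of \<open>k\<close> in the minimiser
    \<open>-a / k\<close>, the trial point exists also for \<open>k = 0\<close> and still makes the
    value negative.\<close>
  have "2 * (-a / (k+1)) * a + (-a / (k+1))\<^sup>2 * k = - (a\<^sup>2 * (k + 2)) / (k+1)\<^sup>2"
    using \<open>0 \<le> k\<close> by (simp add: divide_simps power2_eq_square) algebra
  also have "\<dots> < 0"
    using \<open>0 \<le> k\<close> \<open>a \<noteq> 0\<close> by (intro divide_neg_pos) (auto intro!: mult_pos_pos)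
  finally show False using assms(1)[of "-a / (k+1)"] by linarith
qed

text \<open>The Rayleigh quotient attains its minimum on the compact unit sphere of
  \<open>S\<close>, and a minimiser is an eigenvector. Allowing an invariant subspace makes it
  possible to split off eigenvectors one at a time.\<close>

lemma symmetric_mat_minimal_eigenvector:
  fixes A :: "real^'n^'n"
  assumes sym: "symmetric_mat A" and S: "subspace S" "S \<noteq> {0}"
    and inv: "\<And>v. v \<in> S \<Longrightarrow> A *v v \<in> S"
  obtains e c where "e \<in> S" "norm e = 1" "A *v e = c *\<^sub>R e"
    "\<And>v. v \<in> S \<Longrightarrow> c * (v \<bullet> v) \<le> v \<bullet> (A *v v)"
proof -
  obtain x where x: "x \<in> S" "x \<noteq> 0" using S subspace_0 by blast
  have "compact (sphere 0 1 \<inter> S)"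
    using S(1) by (intro compact_Int_closed closed_subspace) auto
  moreover have "(1 / norm x) *\<^sub>R x \<in> sphere 0 1 \<inter> S"
    using x S(1) by (auto simp: subspace_scale)
  moreover have "continuous_on (sphere 0 1 \<inter> S) (\<lambda>v. v \<bullet> (A *v v))"
    by (intro continuous_intros matrix_vector_mult_linear_continuous_on)
  ultimately obtain e where e: "e \<in> sphere 0 1 \<inter> S"
    and min: "\<And>v. v \<in> sphere 0 1 \<inter> S \<Longrightarrow> e \<bullet> (A *v e) \<le> v \<bullet> (A *v v)"
    using continuous_attains_inf[of "sphere 0 1 \<inter> S" "\<lambda>v. v \<bullet> (A *v v)"] by (metis empty_iff)
  define c where "c = e \<bullet> (A *v e)"
  have e1: "norm e = 1" "e \<in> S" using e by auto
  have ray: "c * (v \<bullet> v) \<le> v \<bullet> (A *v v)" if "v \<in> S" for v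
  proof (cases "v = 0")
    case False
    have "(1 / norm v) *\<^sub>R v \<in> sphere 0 1 \<inter> S"
      using False that S(1) by (auto simp: subspace_scale)
    from min[OF this] have "c \<le> (v \<bullet> (A *v v)) / (norm v)\<^sup>2"
      by (simp add: c_def matrix_vector_mult_scaleR power2_eq_square)
    then show ?thesis using False by (simp add: pos_le_divide_eq dot_square_norm)
  qed simp
  \<comment> \<open>\<open>f\<close> is the defect in the eigenvector equation and also the
    direction of variation: moving from \<open>e\<close> along \<open>f\<close> changes the shifted
    form to first order by a multiple of \<open>f \<bullet> f\<close>, which must therefore
    vanish.\<close>
  define f where "f = A *v e - c *\<^sub>R e"
  have f: "f \<in> S" unfolding f_def using e1 inv S(1) by (simp add: subspace_diff subspace_scale)
  have "0 \<le> 2 * t * (f \<bullet> f) + t\<^sup>2 * (f \<bullet> (A *v f) - c * (f \<bullet> f))" for t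
  proof -
    have "e + t *\<^sub>R f \<in> S" using S(1) e1 f by (simp add: subspace_add subspace_scale)
    from ray[OF this] have "0 \<le> (e + t *\<^sub>R f) \<bullet> (A *v (e + t *\<^sub>R f)) - c * ((e + t *\<^sub>R f) \<bullet> (e + t *\<^sub>R f))"
      by simp
    also have "\<dots> = 2 * t * (f \<bullet> (A *v e) - c * (e \<bullet> f)) + t\<^sup>2 * (f \<bullet> (A *v f) - c * (f \<bullet> f))"
      using e1(1) symmetric_mat_inner[OF sym, of e f] norm_eq_1[of e]
      by (simp add: matrix_vector_right_distrib matrix_vector_mult_scaleR inner_add_left inner_add_right
          c_def[symmetric] inner_commute power2_eq_square algebra_simps)
    also have "f \<bullet> (A *v e) - c * (e \<bullet> f) = f \<bullet> f"
      by (simp add: f_def inner_diff_right inner_diff_left inner_commute algebra_simps)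
    finally show ?thesis .
  qed
  then have "f \<bullet> f = 0"
    using ray[OF f] by (intro linear_coeff_eq_0[of _ "f \<bullet> (A *v f) - c * (f \<bullet> f)"]) auto
  then have "A *v e = c *\<^sub>R e" by (simp add: f_def)
  then show thesis using that e1 ray by blast
qed

text \<open>An orthonormal family of eigenvectors of maximal size must span: otherwise its
  orthogonal complement is a nonzero invariant subspace and contributes one more eigenvector. The
  dimension bounds the size, so a maximum exists.\<close>

lemma symmetric_mat_eigenbasis:
  fixes A :: "real^'n^'n"
  assumes sym: "symmetric_mat A"
  obtains E c where "finite E" "pairwise orthogonal E" "\<And>e. e \<in> E \<Longrightarrow> norm e = 1"
    "\<And>e. e \<in> E \<Longrightarrow> A *v e = c e *\<^sub>R e" "span E = UNIV"
proof -
  define G where "G E \<longleftrightarrow> finite E \<and> pairwise orthogonal E \<and> (\<forall>e\<in>E. norm e = 1 \<and> (\<exists>c. A *v e = c *\<^sub>R e))"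
    for E :: "(real^'n) set"
  have "card E \<le> CARD('n)" if "G E" for E
  proof -
    have "0 \<notin> E" using that by (auto simp: G_def)
    then show ?thesis
      using that pairwise_orthogonal_independent[of E] independent_card_le[of E] by (auto simp: G_def)
  qed
  moreover have "G {}" by (simp add: G_def)
  ultimately obtain E where E: "G E" and max: "\<And>E'. G E' \<Longrightarrow> card E' \<le> card E"
    using ex_has_greatest_nat[of G "{}" card "Suc CARD('n)"] by (auto simp: less_Suc_eq_le)
  have "span E = UNIV"
  proof (rule ccontr)
    assume "span E \<noteq> UNIV"
    then obtain a where a: "a \<noteq> 0" "\<And>x. x \<in> span E \<Longrightarrow> a \<bullet> x = 0"
      using span_not_UNIV_orthogonal by blast
    define W where "W = {w. \<forall>e\<in>E. e \<bullet> w = 0}"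
    have W: "subspace W" by (auto simp: W_def subspace_def inner_add_right)
    have "a \<in> W" using a by (auto simp: W_def inner_commute span_base)
    have inv: "A *v w \<in> W" if "w \<in> W" for w
    proof -
      have "e \<bullet> (A *v w) = 0" if e: "e \<in> E" for e
      proof -
        obtain d where "A *v e = d *\<^sub>R e" using E e by (auto simp: G_def)
        then show ?thesis
          using \<open>w \<in> W\<close> e by (simp add: W_def symmetric_mat_inner[OF sym, symmetric])
      qed
      then show ?thesis by (simp add: W_def)
    qed
    have "W \<noteq> {0}" using \<open>a \<in> W\<close> a(1) by blast
    then obtain e c where e: "e \<in> W" "norm e = 1" "A *v e = c *\<^sub>R e"
      using symmetric_mat_minimal_eigenvector[OF sym W _ inv] by metis
    have "e \<notin> E" using e by (force simp: W_def)
    moreover have "G (insert e E)"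
      using E e by (auto simp: G_def W_def pairwise_insert orthogonal_def inner_commute)
    ultimately show False using max[of "insert e E"] E by (auto simp: G_def)
  qed
  with E show thesis using that[of E "\<lambda>e. SOME c. A *v e = c *\<^sub>R e"] unfolding G_def
    by (metis (mono_tags, lifting) someI_ex)
qed

text \<open>\<open>Min\<close> is informative only on a finite set; finiteness holds because an
  eigenvector cannot be orthogonal to the whole eigenbasis, so its eigenvalue is among those of the
  basis. The minimum \<open>d\<close> of the Rayleigh quotient is itself an eigenvalue, hence an
  upper bound for \<open>lambda_min\<close>.\<close>

lemma lambda_min_le_quadratic_form:
  fixes A :: "real^'n^'n"
  assumes sym: "symmetric_mat A"
  shows "lambda_min A * (v \<bullet> v) \<le> v \<bullet> (A *v v)"
proof -
  let ?L = "{c. \<exists>v. v \<noteq> 0 \<and> A *v v = c *\<^sub>R v}"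
  obtain E c where E: "finite E" "\<And>e. e \<in> E \<Longrightarrow> A *v e = c e *\<^sub>R e" "span E = UNIV"
    using symmetric_mat_eigenbasis[OF sym] by metis
  have "?L \<subseteq> c ` E"
  proof safe
    fix d v assume v: "v \<noteq> 0" "A *v v = d *\<^sub>R v"
    obtain e where e: "e \<in> E" "v \<bullet> e \<noteq> 0"
    proof (rule ccontr)
      assume "\<not> thesis"
      then have "\<And>e. e \<in> E \<Longrightarrow> orthogonal v e" using that by (auto simp: orthogonal_def)
      then have "orthogonal v v" using E(3) by (intro orthogonal_to_span[of v E]) auto
      then show False using v by (simp add: orthogonal_def)
    qed
    have "d * (v \<bullet> e) = c e * (v \<bullet> e)"
      using symmetric_mat_inner[OF sym, of v e] by (simp add: v E(2) e)
    then show "d \<in> c ` E" using e by auto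
  qed
  then have fin: "finite ?L" using E(1) finite_surj by blast
  have "axis undefined 1 \<noteq> (0 :: real^'n)" by simp
  then have "(UNIV :: (real^'n) set) \<noteq> {0}" by blast
  from symmetric_mat_minimal_eigenvector[OF sym subspace_UNIV this]
  obtain e d where e: "norm e = 1" "A *v e = d *\<^sub>R e" and d: "\<And>v. d * (v \<bullet> v) \<le> v \<bullet> (A *v v)"
    by (metis UNIV_I)
  have "d \<in> ?L" using e by (intro CollectI exI[of _ e]) auto
  then have "lambda_min A \<le> d" unfolding lambda_min_def using fin by (intro Min_le)
  then show ?thesis using d[of v] mult_right_mono[of "lambda_min A" d "v \<bullet> v"] by simp
qed

section \<open>Square roots of semidefinite and definite matrices\<close>

lemma pos_semidef_sqrt_exists:
  fixes A :: "real^'n^'n"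
  assumes A: "pos_semidef_mat A"
  obtains B where "pos_semidef_mat B" "B ** B = A"
proof -
  have sym: "symmetric_mat A" using A by (simp add: pos_semidef_mat_def)
  obtain E c where fin: "finite E" and orth: "pairwise orthogonal E" and n: "\<And>e. e \<in> E \<Longrightarrow> norm e = 1"
    and c: "\<And>e. e \<in> E \<Longrightarrow> A *v e = c e *\<^sub>R e" and sp: "span E = UNIV"
    using symmetric_mat_eigenbasis[OF sym] by metis
  have c0: "0 \<le> c e" if "e \<in> E" for e
    using A c[OF that] n[OF that] by (simp add: pos_semidef_mat_def) (metis dot_square_norm inner_scaleR_right mult.right_neutral one_power2)
  \<comment> \<open>\<open>g\<close> keeps the eigenbasis and replaces each eigenvalue by its square
    root, so that \<open>B ** B = A\<close> needs checking on the basis only.\<close>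
  define g where "g v = (\<Sum>e\<in>E. (sqrt (c e) * (e \<bullet> v)) *\<^sub>R e)" for v :: "real^'n"
  have lin: "linear g"
    unfolding g_def by (intro linearI) (simp_all add: inner_add_right algebra_simps sum.distrib scaleR_sum_right)
  define B where "B = matrix g"
  have Bg: "B *v v = g v" for v using lin by (simp add: B_def matrix_works)
  have ge: "g e = sqrt (c e) *\<^sub>R e" if "e \<in> E" for e
  proof -
    have "g e = (\<Sum>e'\<in>E. if e' = e then sqrt (c e) *\<^sub>R e else 0)"
      unfolding g_def using orth n that
      by (intro sum.cong) (auto simp: pairwise_def orthogonal_def dot_square_norm)
    then show ?thesis using fin that by simp
  qed
  have dot: "g v \<bullet> w = (\<Sum>e\<in>E. sqrt (c e) * (e \<bullet> v) * (e \<bullet> w))" for v w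
    by (simp add: g_def inner_sum_left)
  have "symmetric_mat B"
    by (rule symmetric_matI) (simp add: Bg dot inner_commute[of _ "g _"] mult_ac)
  moreover have "0 \<le> v \<bullet> (B *v v)" for v
    using c0 by (simp add: Bg inner_commute[of _ "g _"] dot mult.assoc sum_nonneg)
  ultimately have "pos_semidef_mat B" by (simp add: pos_semidef_mat_def)
  moreover have "(B ** B) *v v = A *v v" for v
  proof (rule linear_eq_on_span[of "(*v) (B ** B)" "(*v) A" E])
    show "(B ** B) *v e = A *v e" if "e \<in> E" for e
      using that c0[OF that]
      by (simp add: matrix_vector_mul_assoc[symmetric] Bg ge linear_scale[OF lin] c)
  qed (use sp in auto)
  then have "B ** B = A" by (simp add: matrix_eq)
  ultimately show thesis using that by blast
qed

lemma pos_def_imp_semidef: "pos_def_mat A \<Longrightarrow> pos_semidef_mat A"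
  unfolding pos_def_mat_def pos_semidef_mat_def
  by (metis inner_zero_left less_le_not_le linorder_linear)

text \<open>A semidefinite root \<open>D\<close> acts on an eigenvector \<open>e\<close> of
  \<open>A\<close> as multiplication by \<open>sqrt (c e)\<close>: it scales the defect
  \<open>f\<close> by the negative number \<open>- sqrt (c e)\<close>, which semidefiniteness allows
  only for \<open>f = 0\<close>. Two roots thus agree on a basis.\<close>

lemma pos_def_sqrt_unique:
  fixes A :: "real^'n^'n"
  assumes A: "pos_def_mat A" and B: "pos_semidef_mat B" "B ** B = A"
    and B': "pos_semidef_mat B'" "B' ** B' = A"
  shows "B = B'"
proof -
  have sym: "symmetric_mat A" using A by (simp add: pos_def_mat_def)
  obtain E c where n: "\<And>e. e \<in> E \<Longrightarrow> norm e = 1"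
    and c: "\<And>e. e \<in> E \<Longrightarrow> A *v e = c e *\<^sub>R e" and sp: "span E = UNIV"
    using symmetric_mat_eigenbasis[OF sym] by metis
  have eig: "D *v e = sqrt (c e) *\<^sub>R e" if D: "pos_semidef_mat D" "D ** D = A" and e: "e \<in> E" for D e
  proof -
    have "e \<noteq> 0" using n[OF e] by auto
    then have "0 < e \<bullet> (A *v e)" using A by (simp add: pos_def_mat_def)
    then have c0: "0 < c e" using n[OF e] by (simp add: c[OF e] dot_square_norm)
    define f where "f = D *v e - sqrt (c e) *\<^sub>R e"
    have "D *v f = D *v (D *v e) - sqrt (c e) *\<^sub>R (D *v e)"
      by (simp add: f_def matrix_vector_mult_diff_distrib matrix_vector_mult_scaleR)
    also have "D *v (D *v e) = c e *\<^sub>R e"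
      using D(2) c[OF e] by (simp add: matrix_vector_mul_assoc)
    finally have "D *v f = - (sqrt (c e) *\<^sub>R f)"
      using c0 by (simp add: f_def algebra_simps)
    moreover have "0 \<le> f \<bullet> (D *v f)" using D(1) by (simp add: pos_semidef_mat_def)
    ultimately have "sqrt (c e) * (f \<bullet> f) \<le> 0" by simp
    then have "f \<bullet> f \<le> 0" using c0 by (simp add: mult_le_0_iff)
    then have "f = 0" by (metis inner_eq_zero_iff inner_ge_zero order.antisym)
    then show ?thesis by (simp add: f_def)
  qed
  have "B *v v = B' *v v" for v
    by (rule linear_eq_on_span[of "(*v) B" "(*v) B'" E]) (use sp eig B B' in auto)
  then show ?thesis by (simp add: matrix_eq)
qed

text \<open>Discharges the definite description in \<open>mat_sqrt\<close>: a semidefinite root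
  written down by hand is the one described.\<close>

lemma mat_sqrt_eqI:
  assumes "pos_def_mat A" "pos_semidef_mat B" "B ** B = A"
  shows "mat_sqrt A = B"
  unfolding mat_sqrt_def using assms pos_def_sqrt_unique by (intro the_equality) blast+

lemma mat_sqrt_pos_def:
  assumes "pos_def_mat A"
  shows "pos_semidef_mat (mat_sqrt A)" "mat_sqrt A ** mat_sqrt A = A"
  using pos_semidef_sqrt_exists[OF pos_def_imp_semidef[OF assms]] mat_sqrt_eqI[OF assms] by metis+

section \<open>Matrix inverses and definiteness\<close>

lemma matrix_inv_invertible:
  fixes A :: "real^'n^'n"
  assumes "invertible A"
  shows "A ** matrix_inv A = mat 1" "matrix_inv A ** A = mat 1"
  using someI_ex[of "\<lambda>A'. A ** A' = mat 1 \<and> A' ** A = mat 1"] assms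
  by (auto simp: matrix_inv_def invertible_def)

lemma matrix_inv_eqI:
  fixes A :: "real^'n^'n"
  assumes "A ** B = mat 1"
  shows "matrix_inv A = B"
proof -
  have "invertible A" using assms invertible_right_inverse by blast
  then show ?thesis
    by (metis assms matrix_inv_invertible(2) matrix_mul_assoc matrix_mul_lid matrix_mul_rid)
qed

lemma matrix_inv_mult_vec:
  fixes A :: "real^'n^'n"
  assumes "invertible A"
  shows "A *v (matrix_inv A *v v) = v" "matrix_inv A *v (A *v v) = v"
  using matrix_inv_invertible[OF assms] by (simp_all add: matrix_vector_mul_assoc)

lemma invertibleI_quadratic_form:
  fixes A :: "real^'n^'n"
  assumes "\<And>v. v \<noteq> 0 \<Longrightarrow> v \<bullet> (A *v v) \<noteq> 0"
  shows "invertible A"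
proof -
  have "v = 0" if "A *v v = 0" for v using that assms[of v] by auto
  then show ?thesis
    by (metis invertible_left_inverse matrix_left_invertible_ker)
qed

lemma pos_def_invertible: "pos_def_mat A \<Longrightarrow> invertible A"
  by (rule invertibleI_quadratic_form) (force simp: pos_def_mat_def)

lemma symmetric_matrix_inv:
  assumes "symmetric_mat A" "invertible A"
  shows "symmetric_mat (matrix_inv A)"
  using assms by (intro symmetric_matI) (metis matrix_inv_mult_vec(1) symmetric_mat_inner)

lemma pos_def_matrix_inv:
  assumes A: "pos_def_mat A"
  shows "pos_def_mat (matrix_inv A)"
proof -
  have inv: "invertible A" using A by (rule pos_def_invertible)
  have "0 < v \<bullet> (matrix_inv A *v v)" if "v \<noteq> 0" for v
  proof -
    have "matrix_inv A *v v \<noteq> 0" using matrix_inv_mult_vec(1)[OF inv, of v] that by auto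
    then show ?thesis
      using A matrix_inv_mult_vec(1)[OF inv, of v] unfolding pos_def_mat_def by (metis inner_commute)
  qed
  then show ?thesis using A inv by (simp add: pos_def_mat_def symmetric_matrix_inv)
qed

text \<open>A vector on which a semidefinite form vanishes minimises it, so the first variation
  \<open>A *v v\<close> vanishes as well; invertibility then leaves only
  \<open>v = 0\<close>.\<close>

lemma invertible_pos_semidef_imp_pos_def:
  fixes A :: "real^'n^'n"
  assumes A: "pos_semidef_mat A" and inv: "invertible A"
  shows "pos_def_mat A"
  unfolding pos_def_mat_def
proof (intro conjI allI impI)
  fix v :: "real^'n" assume v: "v \<noteq> 0"
  show "0 < v \<bullet> (A *v v)"
  proof (rule ccontr)
    assume "\<not> ?thesis"
    then have v0: "v \<bullet> (A *v v) = 0" using A by (auto simp: pos_semidef_mat_def order.antisym not_less)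
    define f where "f = A *v v"
    have sym: "symmetric_mat A" using A by (simp add: pos_semidef_mat_def)
    have "0 \<le> 2 * t * (f \<bullet> f) + t\<^sup>2 * (f \<bullet> (A *v f))" for t
    proof -
      have "0 \<le> (v + t *\<^sub>R f) \<bullet> (A *v (v + t *\<^sub>R f))" using A by (simp add: pos_semidef_mat_def)
      then show ?thesis using v0 symmetric_mat_inner[OF sym, of v f]
        by (simp add: matrix_vector_right_distrib matrix_vector_mult_scaleR inner_add_left
            inner_add_right f_def inner_commute power2_eq_square algebra_simps)
    qed
    then have "f \<bullet> f = 0"
      using A by (intro linear_coeff_eq_0[of _ "f \<bullet> (A *v f)"]) (auto simp: pos_semidef_mat_def)
    then show False using v matrix_inv_mult_vec(2)[OF inv, of v] by (auto simp: f_def)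
  qed
qed (use A in \<open>auto simp: pos_semidef_mat_def\<close>)

section \<open>Quadratic forms of efficiency matrices and of their inverses\<close>

lemma eff_quadratic_form_le:
  fixes V :: "real^'n^'n" and F :: "real^'k^'n"
  assumes V: "symmetric_mat V" "invertible V"
    and nonneg: "\<And>a. 0 \<le> a \<bullet> (V *v a) - 2 * (a \<bullet> (F *v l)) + w"
  shows "l \<bullet> ((transpose F ** matrix_inv V ** F) *v l) \<le> w"
proof -
  have "l \<bullet> ((transpose F ** matrix_inv V ** F) *v l) = (F *v l) \<bullet> (matrix_inv V *v (F *v l))"
    by (simp add: matrix_vector_mul_assoc[symmetric] transpose_matrix_vector)
      (metis dot_lmul_matrix inner_commute)
  \<comment> \<open>This trial vector minimises the quadratic in \<open>a\<close>, and the minimum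
    is \<open>w\<close> minus the efficiency form.\<close>
  then show ?thesis
    using nonneg[of "matrix_inv V *v (F *v l)"] by (simp add: matrix_inv_mult_vec[OF V(2)] inner_commute)
qed

text \<open>Completing the square around the optimal vector \<open>x\<close>: each trial vector
  \<open>a\<close> yields a lower bound, with equality at \<open>a = x\<close>. Later the trial
  vector stands for the working score itself.\<close>

lemma eff_quadratic_form_ge:
  fixes V :: "real^'n^'n" and F :: "real^'k^'n"
  assumes V: "pos_semidef_mat V" "invertible V"
  shows "2 * (a \<bullet> (F *v l)) - a \<bullet> (V *v a) \<le> l \<bullet> ((transpose F ** matrix_inv V ** F) *v l)"
proof -
  define x where "x = matrix_inv V *v (F *v l)"
  have Vx: "V *v x = F *v l" by (simp add: x_def matrix_inv_mult_vec[OF V(2)])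
  have "l \<bullet> ((transpose F ** matrix_inv V ** F) *v l) = (F *v l) \<bullet> x"
    by (simp add: matrix_vector_mul_assoc[symmetric] transpose_matrix_vector x_def)
      (metis dot_lmul_matrix inner_commute)
  moreover have "0 \<le> (a - x) \<bullet> (V *v (a - x))" using V by (simp add: pos_semidef_mat_def)
  moreover have "x \<bullet> (V *v a) = a \<bullet> (F *v l)"
    using V symmetric_mat_inner[of V x a] by (simp add: Vx pos_semidef_mat_def inner_commute)
  ultimately show ?thesis
    by (simp add: matrix_vector_mult_diff_distrib inner_diff_left inner_diff_right Vx inner_commute)
qed

lemma symmetric_eff:
  fixes V :: "real^'n^'n" and F :: "real^'k^'n"
  assumes "symmetric_mat V" "invertible V"
  shows "symmetric_mat (transpose F ** matrix_inv V ** F)"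
  using symmetric_matrix_inv[OF assms]
  by (simp add: symmetric_mat_def matrix_transpose_mul transpose_transpose matrix_mul_assoc)

text \<open>The usual proof that inversion reverses the Loewner order: with \<open>x\<close> and
  \<open>u\<close> the preimages of \<open>v\<close> under \<open>A\<close> and \<open>B\<close>,
  expand the nonnegative \<open>A\<close>-form at \<open>u - k *\<^sub>R x\<close>.\<close>

lemma matrix_inv_antimono:
  fixes A B :: "real^'n^'n"
  assumes A: "pos_def_mat A" and B: "invertible B" and k: "0 < k"
    and le: "\<And>v. v \<bullet> (A *v v) \<le> k * (v \<bullet> (B *v v))"
  shows "v \<bullet> (matrix_inv B *v v) \<le> k * (v \<bullet> (matrix_inv A *v v))"
proof -
  define x u where "x = matrix_inv A *v v" and "u = matrix_inv B *v v"
  have Ax: "A *v x = v" and Bu: "B *v u = v"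
    by (simp_all add: x_def u_def matrix_inv_mult_vec pos_def_invertible A B)
  have sym: "symmetric_mat A" using A by (simp add: pos_def_mat_def)
  have "0 \<le> (u - k *\<^sub>R x) \<bullet> (A *v (u - k *\<^sub>R x))"
    using pos_def_imp_semidef[OF A] by (simp add: pos_semidef_mat_def)
  also have "\<dots> = u \<bullet> (A *v u) - 2 * k * (u \<bullet> v) + k\<^sup>2 * (x \<bullet> v)"
    using symmetric_mat_inner[OF sym, of x u]
    by (simp add: matrix_vector_mult_diff_distrib matrix_vector_mult_scaleR inner_diff_left
        inner_diff_right Ax inner_commute power2_eq_square algebra_simps)
  also have "\<dots> \<le> k * (k * (x \<bullet> v) - u \<bullet> v)"
    using le[of u] by (simp add: Bu power2_eq_square algebra_simps)
  finally show ?thesis using k by (simp add: zero_le_mult_iff x_def u_def inner_commute)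
qed

text \<open>With \<open>S\<close> the inverse root of \<open>matrix_inv N'\<close>, the vector
  \<open>S *v l\<close> has unit length for the form of \<open>matrix_inv N'\<close>, so the
  comparison of inverses bounds the form of \<open>matrix_inv N\<close> there from below by
  \<open>1 / k\<close>. In use, \<open>N\<close> belongs to the competitor and \<open>N'\<close> to
  the working score.\<close>

lemma info_ratio_ge:
  fixes N N' :: "real^'n^'n"
  assumes N: "pos_def_mat N" and N': "pos_def_mat N'" and k: "0 < k"
    and le: "\<And>v. v \<bullet> (N *v v) \<le> k * (v \<bullet> (N' *v v))" and l: "norm l = 1"
  shows "1 / k - 1 \<le> l \<bullet> ((mat_inv_sqrt (matrix_inv N') ** matrix_inv N **
           mat_inv_sqrt (matrix_inv N') - mat 1) *v l)"
proof -
  define B where "B = mat_sqrt (matrix_inv N')"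
  have B: "pos_semidef_mat B" "B ** B = matrix_inv N'"
    using mat_sqrt_pos_def[OF pos_def_matrix_inv[OF N']] by (auto simp: B_def)
  have "B ** (B ** N') = mat 1"
    using B(2) matrix_inv_invertible[OF pos_def_invertible[OF N']] by (simp add: matrix_mul_assoc)
  then have inv: "invertible B" using invertible_right_inverse by blast
  have sym: "symmetric_mat B" using B by (simp add: pos_semidef_mat_def)
  define S where "S = matrix_inv B"
  have symS: "symmetric_mat S" unfolding S_def by (rule symmetric_matrix_inv[OF sym inv])
  define v where "v = S *v l"
  have "v \<bullet> (matrix_inv N' *v v) = (B *v v) \<bullet> (B *v v)"
    by (simp add: B(2)[symmetric] matrix_vector_mul_assoc[symmetric] symmetric_mat_inner[OF sym])
  also have "B *v v = l" by (simp add: v_def S_def matrix_inv_mult_vec[OF inv])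
  finally have "1 \<le> k * (v \<bullet> (matrix_inv N *v v))"
    using matrix_inv_antimono[OF N pos_def_invertible[OF N'] k le, of v] l by (simp add: dot_square_norm)
  moreover have "l \<bullet> ((S ** matrix_inv N ** S) *v l) = v \<bullet> (matrix_inv N *v v)"
    by (simp add: v_def matrix_vector_mul_assoc[symmetric] symmetric_mat_inner[OF symS])
  ultimately show ?thesis
    using k l by (simp add: mat_inv_sqrt_def B_def[symmetric] S_def[symmetric]
        matrix_vector_mult_diff_rdistrib inner_diff_right dot_square_norm field_simps)
qed

section \<open>Quantitative bounds on correlation matrices and their inverses\<close>

lemma norm_matrix_vector_mult_le_sum_abs:
  fixes A :: "real^'n^'m"
  shows "norm (A *v x) \<le> (\<Sum>j\<in>UNIV. \<Sum>k\<in>UNIV. \<bar>A $ j $ k\<bar>) * norm x"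
proof -
  have "norm (A *v x) \<le> (\<Sum>j\<in>UNIV. \<bar>(A *v x) $ j\<bar>)" by (rule norm_le_l1_cart)
  also have "\<dots> \<le> (\<Sum>j\<in>UNIV. \<Sum>k\<in>UNIV. \<bar>A $ j $ k\<bar> * norm x)"
  proof (intro sum_mono)
    fix j
    have "\<bar>(A *v x) $ j\<bar> \<le> (\<Sum>k\<in>UNIV. \<bar>A $ j $ k * x $ k\<bar>)"
      by (simp add: matrix_vector_mult_def sum_abs)
    also have "\<dots> \<le> (\<Sum>k\<in>UNIV. \<bar>A $ j $ k\<bar> * norm x)"
      by (intro sum_mono) (simp add: abs_mult component_le_norm_cart mult_left_mono)
    finally show "\<bar>(A *v x) $ j\<bar> \<le> (\<Sum>k\<in>UNIV. \<bar>A $ j $ k\<bar> * norm x)" .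
  qed
  finally show ?thesis by (simp add: sum_distrib_right)
qed

text \<open>The smallest eigenvalue is such a \<open>K\<close>. This serves the initial working
  matrix, for which no eigenvalue bound is given.\<close>

lemma pos_def_lower_bound:
  fixes A :: "real^'n^'n"
  assumes "pos_def_mat A"
  obtains K where "0 < K" "\<And>v. K * (v \<bullet> v) \<le> v \<bullet> (A *v v)"
proof -
  have "axis undefined 1 \<noteq> (0 :: real^'n)" by simp
  then have nz: "(UNIV :: (real^'n) set) \<noteq> {0}" by blast
  have sym: "symmetric_mat A" using assms by (simp add: pos_def_mat_def)
  obtain e d where e: "norm e = 1" "A *v e = d *\<^sub>R e" and d: "\<And>v. d * (v \<bullet> v) \<le> v \<bullet> (A *v v)"
    using symmetric_mat_minimal_eigenvector[OF sym subspace_UNIV nz] by (metis UNIV_I)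
  have "e \<noteq> 0" using e(1) by auto
  then have "0 < e \<bullet> (A *v e)" using assms by (simp add: pos_def_mat_def)
  then have "0 < d" using e by (simp add: dot_square_norm)
  then show thesis using d that by blast
qed

lemma coercive_pos_def:
  fixes A :: "real^'n^'n"
  assumes "symmetric_mat A" "0 < K" "\<And>v. K * (v \<bullet> v) \<le> v \<bullet> (A *v v)"
  shows "pos_def_mat A"
  unfolding pos_def_mat_def
proof (intro conjI allI impI)
  fix v :: "real^'n" assume "v \<noteq> 0"
  then have "0 < K * (v \<bullet> v)" using assms(2) by simp
  then show "0 < v \<bullet> (A *v v)" using assms(3)[of v] by linarith
qed fact

text \<open>For the preimage \<open>x\<close> of \<open>v\<close>, coercivity bounds
  \<open>K\<close> times the squared norm of \<open>x\<close> by \<open>x \<bullet> v\<close>, to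
  which Cauchy-Schwarz applies.\<close>

lemma coercive_norm_matrix_inv_le:
  fixes A :: "real^'n^'n"
  assumes A: "symmetric_mat A" "0 < K" "\<And>v. K * (v \<bullet> v) \<le> v \<bullet> (A *v v)"
  shows "norm (matrix_inv A *v v) \<le> norm v / K"
proof -
  define x where "x = matrix_inv A *v v"
  have "A *v x = v"
    using pos_def_invertible[OF coercive_pos_def[OF A]] by (simp add: x_def matrix_inv_mult_vec)
  then have "K * (norm x)\<^sup>2 \<le> norm x * norm v"
    using A(3)[of x] norm_cauchy_schwarz[of x v] by (simp add: dot_square_norm)
  then have "norm x * (K * norm x) \<le> norm x * norm v" by (simp add: power2_eq_square mult_ac)
  then have "K * norm x \<le> norm v" by (cases "norm x = 0") auto
  then show ?thesis using A(2) by (simp add: x_def field_simps)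
qed

lemma coercive_matrix_inv_le:
  fixes A :: "real^'n^'n"
  assumes A: "symmetric_mat A" "0 < K" "\<And>v. K * (v \<bullet> v) \<le> v \<bullet> (A *v v)"
  shows "v \<bullet> (matrix_inv A *v v) \<le> (v \<bullet> v) / K"
proof -
  have "v \<bullet> (matrix_inv A *v v) \<le> norm v * norm (matrix_inv A *v v)" by (rule norm_cauchy_schwarz)
  also have "\<dots> \<le> norm v * (norm v / K)"
    by (intro mult_left_mono coercive_norm_matrix_inv_le[OF A]) auto
  finally show ?thesis by (simp add: dot_square_norm power2_eq_square)
qed

lemma matrix_inv_mat1: "matrix_inv (mat 1 :: real^'n^'n) = mat 1"
  by (rule matrix_inv_eqI) simp

lemma matrix_inv_lower_bound:
  fixes A :: "real^'n^'n"
  assumes "pos_def_mat A" "0 < B" "\<And>v. v \<bullet> (A *v v) \<le> B * (v \<bullet> v)"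
  shows "(v \<bullet> v) / B \<le> v \<bullet> (matrix_inv A *v v)"
proof -
  have "invertible (mat 1 :: real^'n^'n)" unfolding invertible_def by (intro exI[of _ "mat 1"]) simp
  from matrix_inv_antimono[OF assms(1) this assms(2), of v] assms(2,3) show ?thesis
    by (simp add: matrix_inv_mat1 field_simps)
qed

text \<open>Testing the form on sums and differences of two basis vectors shows that all entries lie
  between -1 and 1; each product of coordinates is then at most the mean of their squares. The
  all-ones matrix attains the bound.\<close>

lemma correlation_upper_bound:
  fixes A :: "real^'n^'n"
  assumes A: "pos_semidef_mat A" and d: "\<And>j. A $ j $ j = 1"
  shows "v \<bullet> (A *v v) \<le> real CARD('n) * (v \<bullet> v)"
proof -
  have sym: "A $ j $ k = A $ k $ j" for j k
  proof -
    have "A = transpose A" using A by (simp add: pos_semidef_mat_def symmetric_mat_def)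
    then have "A $ j $ k = transpose A $ j $ k" by (rule arg_cong)
    then show ?thesis by (simp add: transpose_def)
  qed
  have entry: "axis j 1 \<bullet> (A *v axis k 1) = A $ j $ k" for j k
    by (simp add: matrix_vector_mult_basis column_def inner_axis')
  have bd: "\<bar>A $ j $ k\<bar> \<le> 1" for j k
  proof -
    have "0 \<le> (axis j 1 + axis k 1) \<bullet> (A *v (axis j 1 + axis k 1))"
      "0 \<le> (axis j 1 - axis k 1) \<bullet> (A *v (axis j 1 - axis k 1))"
      using A by (simp_all add: pos_semidef_mat_def)
    then have "0 \<le> 2 + 2 * A $ j $ k" "0 \<le> 2 - 2 * A $ j $ k"
      using sym[of j k]
      by (simp_all add: matrix_vector_right_distrib matrix_vector_mult_diff_distrib inner_add_left
          inner_add_right inner_diff_left inner_diff_right entry d)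
    then show ?thesis by linarith
  qed
  have "v \<bullet> (A *v v) = (\<Sum>j\<in>UNIV. \<Sum>k\<in>UNIV. v $ j * A $ j $ k * v $ k)"
    by (simp add: inner_vec_def matrix_vector_mult_def sum_distrib_left mult_ac)
  also have "\<dots> \<le> (\<Sum>j\<in>UNIV. \<Sum>k\<in>UNIV. ((v $ j)\<^sup>2 + (v $ k)\<^sup>2) / 2)"
  proof (intro sum_mono)
    fix j k
    have "v $ j * A $ j $ k * v $ k \<le> \<bar>v $ j * A $ j $ k * v $ k\<bar>" by (rule abs_ge_self)
    also have "\<dots> = \<bar>A $ j $ k\<bar> * (\<bar>v $ j\<bar> * \<bar>v $ k\<bar>)" by (simp add: abs_mult)
    also have "\<dots> \<le> 1 * (\<bar>v $ j\<bar> * \<bar>v $ k\<bar>)" using bd by (intro mult_right_mono) auto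
    also have "\<dots> \<le> ((v $ j)\<^sup>2 + (v $ k)\<^sup>2) / 2"
      using sum_squares_bound[of "\<bar>v $ j\<bar>" "\<bar>v $ k\<bar>"] by simp
    finally show "v $ j * A $ j $ k * v $ k \<le> ((v $ j)\<^sup>2 + (v $ k)\<^sup>2) / 2" .
  qed
  also have "\<dots> = (\<Sum>j\<in>(UNIV::'n set). \<Sum>k\<in>(UNIV::'n set). (v $ j)\<^sup>2 / 2) +
      (\<Sum>j\<in>(UNIV::'n set). \<Sum>k\<in>UNIV. (v $ k)\<^sup>2 / 2)"
    by (simp only: sum.distrib add_divide_distrib)
  also have "(\<Sum>j\<in>(UNIV::'n set). \<Sum>k\<in>(UNIV::'n set). (v $ j)\<^sup>2 / 2) = real CARD('n) * ((v \<bullet> v) / 2)"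
    by (simp add: inner_vec_def power2_eq_square sum_distrib_left sum_divide_distrib)
  also have "(\<Sum>j\<in>(UNIV::'n set). \<Sum>k\<in>UNIV. (v $ k)\<^sup>2 / 2) = real CARD('n) * ((v \<bullet> v) / 2)"
    by (simp add: inner_vec_def power2_eq_square sum_divide_distrib)
  finally show ?thesis by (simp add: mult.commute)
qed

text \<open>The resolvent identity \<open>Q *v u = (R - Q) *v x\<close> makes the first bound small
  when the entries of \<open>R\<close> and \<open>Q\<close> are close. The second bound ignores
  closeness and is a fixed multiple of \<open>v \<bullet> v\<close>.\<close>

lemma inverse_discrepancy:
  fixes Q R :: "real^'n^'n" and v :: "real^'n"
  assumes Q: "symmetric_mat Q" "0 < C" "\<And>v. C * (v \<bullet> v) \<le> v \<bullet> (Q *v v)"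
    and up: "\<And>v. v \<bullet> (Q *v v) \<le> B * (v \<bullet> v)"
    and R: "symmetric_mat R" "0 < K" "\<And>v. K * (v \<bullet> v) \<le> v \<bullet> (R *v v)"
  defines "u \<equiv> matrix_inv Q *v v - matrix_inv R *v v"
  shows "u \<bullet> (Q *v u) \<le> (\<Sum>j\<in>UNIV. \<Sum>k\<in>UNIV. \<bar>R $ j $ k - Q $ j $ k\<bar>)\<^sup>2 / (C * K\<^sup>2) * (v \<bullet> v)"
    and "u \<bullet> (Q *v u) \<le> (2 / C + 2 * B / K\<^sup>2) * (v \<bullet> v)"
proof -
  define x z where "x = matrix_inv R *v v" and "z = matrix_inv Q *v v"
  have inv: "invertible Q" "invertible R"
    using coercive_pos_def Q R pos_def_invertible by blast+
  have Qz: "Q *v z = v" and Rx: "R *v x = v"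
    by (simp_all add: x_def z_def matrix_inv_mult_vec inv)
  have u: "u = z - x" by (simp add: u_def x_def z_def)
  have nx: "norm x \<le> norm v / K" unfolding x_def by (rule coercive_norm_matrix_inv_le[OF R])
  have xx: "x \<bullet> x \<le> (v \<bullet> v) / K\<^sup>2"
    using power_mono[OF nx, of 2] by (simp add: dot_square_norm power_divide)
  define t where "t = (R - Q) *v x"
  have Qu: "Q *v u = t" by (simp add: u t_def matrix_vector_mult_diff_distrib matrix_vector_mult_diff_rdistrib Qz Rx)
  then have ut: "u = matrix_inv Q *v t" using matrix_inv_mult_vec(2)[OF inv(1), of u] by simp
  have "u \<bullet> (Q *v u) = t \<bullet> u" by (simp only: Qu inner_commute)
  also have "\<dots> = t \<bullet> (matrix_inv Q *v t)" by (simp only: ut)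
  also have "\<dots> \<le> (t \<bullet> t) / C" by (rule coercive_matrix_inv_le[OF Q])
  also have "\<dots> \<le> ((\<Sum>j\<in>UNIV. \<Sum>k\<in>UNIV. \<bar>R $ j $ k - Q $ j $ k\<bar>)\<^sup>2 * ((v \<bullet> v) / K\<^sup>2)) / C"
  proof (rule divide_right_mono)
    have "norm t \<le> (\<Sum>j\<in>UNIV. \<Sum>k\<in>UNIV. \<bar>R $ j $ k - Q $ j $ k\<bar>) * norm x"
      using norm_matrix_vector_mult_le_sum_abs[of "R - Q" x] by (simp add: t_def)
    from power_mono[OF this, of 2]
    have "t \<bullet> t \<le> (\<Sum>j\<in>UNIV. \<Sum>k\<in>UNIV. \<bar>R $ j $ k - Q $ j $ k\<bar>)\<^sup>2 * (x \<bullet> x)"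
      by (simp add: dot_square_norm power_mult_distrib)
    also have "\<dots> \<le> (\<Sum>j\<in>UNIV. \<Sum>k\<in>UNIV. \<bar>R $ j $ k - Q $ j $ k\<bar>)\<^sup>2 * ((v \<bullet> v) / K\<^sup>2)"
      using xx by (intro mult_left_mono) auto
    finally show "t \<bullet> t \<le> (\<Sum>j\<in>UNIV. \<Sum>k\<in>UNIV. \<bar>R $ j $ k - Q $ j $ k\<bar>)\<^sup>2 * ((v \<bullet> v) / K\<^sup>2)" .
  qed (use Q in auto)
  finally show "u \<bullet> (Q *v u) \<le> (\<Sum>j\<in>UNIV. \<Sum>k\<in>UNIV. \<bar>R $ j $ k - Q $ j $ k\<bar>)\<^sup>2 / (C * K\<^sup>2) * (v \<bullet> v)"
    by (simp add: mult_ac)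
  have nonneg: "0 \<le> a \<bullet> (Q *v a)" for a
    using pos_def_imp_semidef[OF coercive_pos_def[OF Q]] by (simp add: pos_semidef_mat_def)
  have B: "0 \<le> B"
  proof -
    fix j :: 'n
    have "0 \<le> B * ((axis j 1 :: real^'n) \<bullet> axis j 1)"
      using up[of "axis j 1"] nonneg[of "axis j 1"] by linarith
    then show ?thesis by simp
  qed
  \<comment> \<open>The parallelogram identity for the form of \<open>Q\<close>, with the
    nonnegative term at \<open>z + x\<close> dropped.\<close>
  have "0 \<le> (z + x) \<bullet> (Q *v (z + x))" by (rule nonneg)
  then have "u \<bullet> (Q *v u) \<le> 2 * (z \<bullet> (Q *v z)) + 2 * (x \<bullet> (Q *v x))"
    by (simp add: u matrix_vector_right_distrib matrix_vector_mult_diff_distrib inner_add_left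
        inner_add_right inner_diff_left inner_diff_right)
  also have "z \<bullet> (Q *v z) \<le> (v \<bullet> v) / C"
    using coercive_matrix_inv_le[where v = v, OF Q] Qz by (simp add: z_def inner_commute)
  also have "x \<bullet> (Q *v x) \<le> B * ((v \<bullet> v) / K\<^sup>2)"
    using up[of x] mult_left_mono[OF xx B] by linarith
  finally show "u \<bullet> (Q *v u) \<le> (2 / C + 2 * B / K\<^sup>2) * (v \<bullet> v)"
    by (simp add: algebra_simps)
qed


section \<open>Measurability and square integrability\<close>

lemma borel_measurable_det:
  fixes R :: "'w \<Rightarrow> real^'n^'n"
  assumes "\<And>j k. (\<lambda>w. R w $ j $ k) \<in> borel_measurable N"
  shows "(\<lambda>w. det (R w)) \<in> borel_measurable N"
  unfolding det_def using assms by (intro borel_measurable_sum borel_measurable_times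
    borel_measurable_prod borel_measurable_const)

text \<open>Cramer's rule expresses the entries of the inverse as quotients of determinants, which
  are polynomials in the entries.\<close>

lemma borel_measurable_matrix_inv:
  fixes R :: "'w \<Rightarrow> real^'n^'n"
  assumes R: "\<And>j k. (\<lambda>w. R w $ j $ k) \<in> borel_measurable N"
  shows "(\<lambda>w. matrix_inv (R w) $ j $ k) \<in> borel_measurable N"
proof -
  define D where "D w = det (\<chi> i l. if l = j then axis k 1 $ i else R w $ i $ l)" for w
  have [measurable]: "D \<in> borel_measurable N"
    unfolding D_def using R by (intro borel_measurable_det) auto
  have [measurable]: "(\<lambda>w. det (R w)) \<in> borel_measurable N" by (rule borel_measurable_det[OF R])
  \<comment> \<open>On singular matrices \<open>matrix_inv\<close> chooses from an empty predicate.
    That predicate is the same for all of them, so the value is one fixed matrix and measurability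
    survives.\<close>
  have "matrix_inv (R w) $ j $ k =
      (if det (R w) = 0 then (SOME B::real^'n^'n. False) $ j $ k else D w / det (R w))" for w
  proof (cases "det (R w) = 0")
    case True
    then have "\<not> (\<exists>B. R w ** B = mat 1 \<and> B ** R w = mat 1)"
      using invertible_det_nz[of "R w"] by (simp add: invertible_def)
    then have "(\<lambda>B. R w ** B = mat 1 \<and> B ** R w = mat 1) = (\<lambda>B. False)" by blast
    then show ?thesis using True by (simp add: matrix_inv_def)
  next
    case False
    have "R w *v (matrix_inv (R w) *v axis k 1) = axis k 1"
      using False by (intro matrix_inv_mult_vec(1)) (simp add: invertible_det_nz)
    then have "(matrix_inv (R w) *v axis k 1) $ j = D w / det (R w)"
      using cramer[OF False] by (simp add: D_def)
    then show ?thesis using False by (simp add: matrix_vector_mult_basis column_def)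
  qed
  then show ?thesis by simp
qed

text \<open>Measurability of \<open>f\<close> is stated separately because integrability of the
  square says nothing about the sign of \<open>f\<close>.\<close>

definition sq_integrable :: "'w measure \<Rightarrow> ('w \<Rightarrow> real) \<Rightarrow> bool" where
  "sq_integrable Q f \<longleftrightarrow> f \<in> borel_measurable Q \<and> integrable Q (\<lambda>w. (f w)\<^sup>2)"

lemma sq_integrable_mult:
  assumes "sq_integrable Q f" "sq_integrable Q g"
  shows "integrable Q (\<lambda>w. f w * g w)"
proof (rule Bochner_Integration.integrable_bound)
  show "integrable Q (\<lambda>w. (f w)\<^sup>2 + (g w)\<^sup>2)" using assms by (simp add: sq_integrable_def)
  show "(\<lambda>w. f w * g w) \<in> borel_measurable Q"
    using assms by (auto simp: sq_integrable_def intro: borel_measurable_times)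
  have "\<bar>x * y\<bar> \<le> x\<^sup>2 + y\<^sup>2" for x y :: real
  proof -
    have "2 * (\<bar>x\<bar> * \<bar>y\<bar>) \<le> x\<^sup>2 + y\<^sup>2" using sum_squares_bound[of "\<bar>x\<bar>" "\<bar>y\<bar>"] by simp
    moreover have "0 \<le> \<bar>x\<bar> * \<bar>y\<bar>" by simp
    ultimately show ?thesis unfolding abs_mult by linarith
  qed
  then show "AE w in Q. norm (f w * g w) \<le> norm ((f w)\<^sup>2 + (g w)\<^sup>2)" by simp
qed

lemma sq_integrable_add:
  assumes "sq_integrable Q f" "sq_integrable Q g"
  shows "sq_integrable Q (\<lambda>w. f w + g w)"
proof -
  have "(\<lambda>w. (f w + g w)\<^sup>2) = (\<lambda>w. (f w)\<^sup>2 + (g w)\<^sup>2 + 2 * (f w * g w))"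
    by (auto simp: power2_eq_square algebra_simps)
  then show ?thesis
    using assms sq_integrable_mult[OF assms]
    by (auto simp: sq_integrable_def intro: borel_measurable_add)
qed

lemma sq_integrable_scale: "sq_integrable Q f \<Longrightarrow> sq_integrable Q (\<lambda>w. f w * c)"
  by (auto simp: sq_integrable_def power_mult_distrib intro: borel_measurable_times)

lemma sq_integrable_zero: "sq_integrable Q (\<lambda>w. 0)"
  by (simp add: sq_integrable_def)

lemma sq_integrable_sum:
  assumes "\<And>i. i \<in> I \<Longrightarrow> sq_integrable Q (f i)"
  shows "sq_integrable Q (\<lambda>w. \<Sum>i\<in>I. f i w)"
  using assms by (induction I rule: infinite_finite_induct) (auto simp: sq_integrable_zero sq_integrable_add)

lemma sq_integrable_AE_bounded:
  assumes "finite_measure Q" "f \<in> borel_measurable Q" "AE w in Q. \<bar>f w\<bar> \<le> B"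
  shows "sq_integrable Q f"
proof -
  interpret finite_measure Q by fact
  have "AE w in Q. norm ((f w)\<^sup>2) \<le> B\<^sup>2"
    using assms(3) by eventually_elim (metis abs_ge_zero norm_power power2_abs power_mono real_norm_def)
  then show ?thesis using assms(2) by (auto simp: sq_integrable_def intro!: integrable_const_bound)
qed

lemma (in finite_measure) sq_integrable_imp_integrable:
  assumes "sq_integrable M f"
  shows "integrable M f"
  using sq_integrable_mult[OF assms sq_integrable_AE_bounded[of M "\<lambda>_. 1" 1]] finite_measure_axioms by simp

text \<open>Bounded convergence in probability, with the truncation level \<open>K2\<close> as
  bound. Where all entries are at most \<open>r\<close> the integrand is below \<open>e / 2\<close>;
  the other outcomes have small probability and cost at most \<open>K2\<close>.\<close>

lemma (in prob_space) integral_truncated_square_tendsto_0: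
  fixes D :: "nat \<Rightarrow> 'j::finite \<Rightarrow> 'k::finite \<Rightarrow> 'a \<Rightarrow> real"
  assumes meas: "\<And>n j k. n \<ge> 1 \<Longrightarrow> D n j k \<in> borel_measurable M"
    and lim: "\<And>j k. to_zero_in_prob M (\<lambda>n. D n j k)" and K: "0 \<le> K1" "0 \<le> K2"
  shows "(\<lambda>n. \<integral>w. min (K1 * (\<Sum>j\<in>UNIV. \<Sum>k\<in>UNIV. \<bar>D n j k w\<bar>)\<^sup>2) K2 \<partial>M) \<longlonglongrightarrow> 0"
proof -
  let ?Z = "\<lambda>n w. min (K1 * (\<Sum>j\<in>UNIV. \<Sum>k\<in>UNIV. \<bar>D n j k w\<bar>)\<^sup>2) K2"
  have nonneg: "0 \<le> (\<integral>w. ?Z n w \<partial>M)" for n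
    using K by (intro integral_nonneg_AE) auto
  have "\<forall>\<^sub>F n in sequentially. (\<integral>w. ?Z n w \<partial>M) < e" if e: "0 < e" for e
  proof -
    define N where "N = real CARD('j) * real CARD('k)"
    \<comment> \<open>\<open>N\<close> counts the entries, so \<open>N * r\<close> bounds their sum
      wherever each is at most \<open>r\<close>; continuity at 0 provides a suitable positive
      \<open>r\<close>.\<close>
    have "((\<lambda>x. K1 * (N * x)\<^sup>2) \<longlongrightarrow> K1 * (N * 0)\<^sup>2) (at_right 0)"
      by (intro tendsto_intros)
    then have "\<forall>\<^sub>F x in at_right 0. K1 * (N * x)\<^sup>2 < e / 2"
      using e by (intro order_tendstoD) auto
    then have "\<forall>\<^sub>F x in at_right (0::real). K1 * (N * x)\<^sup>2 < e / 2 \<and> x > 0"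
      by (intro eventually_conj eventually_at_right_less)
    then obtain r where r: "K1 * (N * r)\<^sup>2 < e / 2" "r > 0"
      using eventually_happens trivial_limit_at_right_real by blast
    let ?I = "\<lambda>n j k. {w \<in> space M. r < \<bar>D n j k w\<bar>}"
    have "(\<lambda>n. K2 * (\<Sum>j\<in>UNIV. \<Sum>k\<in>UNIV. measure M (?I n j k))) \<longlonglongrightarrow> K2 * (\<Sum>j\<in>(UNIV::'j set). \<Sum>k\<in>(UNIV::'k set). 0)"
      using lim r(2) by (intro tendsto_intros) (simp add: to_zero_in_prob_def)
    then have "\<forall>\<^sub>F n in sequentially. K2 * (\<Sum>j\<in>UNIV. \<Sum>k\<in>UNIV. measure M (?I n j k)) < e / 2"
      using e by (intro order_tendstoD) auto
    then show ?thesis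
      using eventually_ge_at_top[of 1]
    proof eventually_elim
      case (elim n)
      note [measurable] = meas[OF elim(2)]
      have I [measurable]: "?I n j k \<in> sets M" for j k by measurable
      have int: "integrable M (indicator (?I n j k) :: _ \<Rightarrow> real)" for j k
        by (intro integrable_real_indicator I) (simp add: emeasure_eq_measure)
      \<comment> \<open>The sum of the indicators dominates the indicator of the union, which turns
        into a union bound after integration.\<close>
      have bd: "?Z n w \<le> e / 2 + K2 * (\<Sum>j\<in>UNIV. \<Sum>k\<in>UNIV. indicator (?I n j k) w)" if w: "w \<in> space M" for w
      proof (cases "\<exists>j k. w \<in> ?I n j k")
        case True
        then obtain j0 k0 where jk: "w \<in> ?I n j0 k0" by blast
        have "1 \<le> (\<Sum>k\<in>UNIV. indicator (?I n j0 k) w :: real)"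
          using member_le_sum[of k0 UNIV "\<lambda>k. indicator (?I n j0 k) w :: real"] jk by simp
        also have "\<dots> \<le> (\<Sum>j\<in>UNIV. \<Sum>k\<in>UNIV. indicator (?I n j k) w)"
          by (rule member_le_sum[of j0 UNIV "\<lambda>j. \<Sum>k\<in>UNIV. indicator (?I n j k) w :: real"]) (auto intro: sum_nonneg)
        finally have "K2 * 1 \<le> K2 * (\<Sum>j\<in>UNIV. \<Sum>k\<in>UNIV. indicator (?I n j k) w)"
          using K(2) by (intro mult_left_mono)
        then show ?thesis using e by linarith
      next
        case False
        then have "(\<Sum>j\<in>UNIV. \<Sum>k\<in>UNIV. \<bar>D n j k w\<bar>) \<le> (\<Sum>j\<in>(UNIV::'j set). \<Sum>k\<in>(UNIV::'k set). r)"
          using w by (intro sum_mono) (auto simp: not_less)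
        then have "(\<Sum>j\<in>UNIV. \<Sum>k\<in>UNIV. \<bar>D n j k w\<bar>)\<^sup>2 \<le> (N * r)\<^sup>2"
          by (intro power_mono) (auto simp: N_def mult_ac intro!: sum_nonneg)
        then have "?Z n w \<le> e / 2"
          using mult_left_mono[OF _ K(1), of _ "(N * r)\<^sup>2"] r(1) by (meson min.coboundedI1 less_imp_le order_trans)
        moreover have "0 \<le> K2 * (\<Sum>j\<in>UNIV. \<Sum>k\<in>UNIV. indicator (?I n j k) w)"
          using K(2) by (intro mult_nonneg_nonneg sum_nonneg) auto
        ultimately show ?thesis by linarith
      qed
      have "(\<integral>w. ?Z n w \<partial>M) \<le> (\<integral>w. e / 2 + K2 * (\<Sum>j\<in>UNIV. \<Sum>k\<in>UNIV. indicator (?I n j k) w) \<partial>M)"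
      proof (rule integral_mono)
        show "integrable M (?Z n)"
          using K by (intro integrable_const_bound[where B=K2]) auto
        show "integrable M (\<lambda>w. e / 2 + K2 * (\<Sum>j\<in>UNIV. \<Sum>k\<in>UNIV. indicator (?I n j k) w))"
          using int by (intro Bochner_Integration.integrable_add integrable_mult_right
              Bochner_Integration.integrable_sum) auto
      qed (use bd in auto)
      also have "\<dots> = e / 2 + K2 * (\<Sum>j\<in>UNIV. \<Sum>k\<in>UNIV. measure M (?I n j k))"
        using int I by (subst Bochner_Integration.integral_add) (auto simp: prob_space)
      also have "\<dots> < e" using elim(1) by linarith
      finally show ?case .
    qed
  qed
  then show ?thesis
    using nonneg by (intro order_tendstoI) (auto intro: less_le_trans eventuallyI)
qed

text \<open>A Toeplitz argument. The initial terms contribute at most a fixed multiple of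
  \<open>l \<bullet> l\<close>, which the diverging \<open>L n\<close> absorbs; the later ones carry
  a factor of at most \<open>e / 2\<close>. As the bounds scale with \<open>l \<bullet> l\<close>,
  one threshold for \<open>n\<close> serves every \<open>l\<close>.\<close>

lemma weighted_information_negligible:
  fixes H :: "nat \<Rightarrow> real^'p \<Rightarrow> real" and d :: "nat \<Rightarrow> real"
  assumes H: "\<And>i l. 0 \<le> H i l" and d: "d \<longlonglongrightarrow> 0" "\<And>i. d i \<le> D"
    and up: "\<And>n. \<exists>G. \<forall>l. (\<Sum>i=1..n. H i l) \<le> G * (l \<bullet> l)"
    and low: "\<And>n l. L n * (l \<bullet> l) \<le> (\<Sum>i=1..n. H i l)"
    and L: "filterlim L at_top sequentially" and e: "0 < e"
  shows "\<forall>\<^sub>F n in sequentially. \<forall>l. (\<Sum>i=1..n. H i l * d i) \<le> e * (\<Sum>i=1..n. H i l)"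
proof -
  have "\<forall>\<^sub>F i in sequentially. d i < e / 2" using d(1) e by (intro order_tendstoD) auto
  then obtain N where N: "\<And>i. i \<ge> N \<Longrightarrow> d i \<le> e / 2"
    unfolding eventually_sequentially by (meson less_imp_le)
  obtain G where G: "\<And>l. (\<Sum>i=1..N. H i l) \<le> G * (l \<bullet> l)" using up by blast
  define D' where "D' = max D 0"
  \<comment> \<open>The threshold makes \<open>D' * G\<close> at most \<open>e / 2 * L n\<close>, so
    the initial block uses half of the allowance.\<close>
  have "\<forall>\<^sub>F n in sequentially. 2 * (D' * G) / e \<le> L n" using L by (simp add: filterlim_at_top)
  then show ?thesis using eventually_ge_at_top[of N]
  proof eventually_elim
    case (elim n)
    show ?case
    proof
      fix l
      have split: "{1..n} = {1..N} \<union> {N<..n}" "{1..N} \<inter> {N<..n} = {}" using elim(2) by auto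
      have "(\<Sum>i=1..n. H i l * d i) = (\<Sum>i=1..N. H i l * d i) + (\<Sum>i\<in>{N<..n}. H i l * d i)"
        unfolding split(1) using split(2) by (intro sum.union_disjoint) auto
      also have "(\<Sum>i=1..N. H i l * d i) \<le> D' * (\<Sum>i=1..N. H i l)"
        unfolding sum_distrib_left
      proof (intro sum_mono)
        fix i
        have "H i l * d i \<le> H i l * D'"
          using H d(2)[of i] by (intro mult_left_mono) (auto simp: D'_def)
        then show "H i l * d i \<le> D' * H i l" by (simp add: mult.commute)
      qed
      also have "\<dots> \<le> D' * (G * (l \<bullet> l))" using G by (intro mult_left_mono) (auto simp: D'_def)
      also have "\<dots> = (D' * G) * (l \<bullet> l)" by simp
      also have "\<dots> \<le> (e / 2 * L n) * (l \<bullet> l)"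
        using elim(1) e by (intro mult_right_mono) (auto simp: field_simps)
      also have "\<dots> = e / 2 * (L n * (l \<bullet> l))" by simp
      also have "\<dots> \<le> e / 2 * (\<Sum>i=1..n. H i l)" using low e by (intro mult_left_mono) auto
      also have "(\<Sum>i\<in>{N<..n}. H i l * d i) \<le> e / 2 * (\<Sum>i\<in>{N<..n}. H i l)"
        unfolding sum_distrib_left
      proof (intro sum_mono)
        fix i assume "i \<in> {N<..n}"
        then have "H i l * d i \<le> H i l * (e / 2)" using H N[of i] by (intro mult_left_mono) auto
        then show "H i l * d i \<le> e / 2 * H i l" by (simp add: mult.commute)
      qed
      also have "\<dots> \<le> e / 2 * (\<Sum>i=1..n. H i l)"
        using H e split by (intro mult_left_mono sum_mono2) auto
      finally show "(\<Sum>i=1..n. H i l * d i) \<le> e * (\<Sum>i=1..n. H i l)" by simp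
    qed
  qed
qed

lemma cov_mat_quadratic_form:
  fixes f :: "'w \<Rightarrow> real^'p"
  assumes sq: "\<And>u. sq_integrable Q (\<lambda>w. f w $ u)" and mean: "\<And>u. (\<integral>w. f w $ u \<partial>Q) = 0"
  shows "a \<bullet> (cov_mat Q f *v a') = (\<integral>w. (a \<bullet> f w) * (a' \<bullet> f w) \<partial>Q)"
proof -
  have int: "integrable Q (\<lambda>w. f w $ u * f w $ v)" for u v by (intro sq_integrable_mult sq)
  have "(\<integral>w. (a \<bullet> f w) * (a' \<bullet> f w) \<partial>Q) =
      (\<integral>w. (\<Sum>u\<in>UNIV. \<Sum>v\<in>UNIV. (a $ u * a' $ v) * (f w $ u * f w $ v)) \<partial>Q)"
    by (simp add: inner_vec_def sum_product mult_ac)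
  also have "\<dots> = (\<Sum>u\<in>UNIV. \<Sum>v\<in>UNIV. (a $ u * a' $ v) * (\<integral>w. f w $ u * f w $ v \<partial>Q))"
    using int by simp
  also have "\<dots> = a \<bullet> (cov_mat Q f *v a')"
    by (simp add: cov_mat_def mean inner_vec_def matrix_vector_mult_def sum_distrib_left mult_ac)
  finally show ?thesis by simp
qed

text \<open>A partial derivative is the pointwise limit of difference quotients along a fixed
  sequence of steps; each quotient is measurable as long as the shifted parameter stays in
  \<open>T\<close>.\<close>

lemma partial_deriv_measurable:
  fixes f :: "real^'p \<Rightarrow> 'w \<Rightarrow> real"
  assumes T: "open T" "b \<in> T" and meas: "\<And>b. b \<in> T \<Longrightarrow> f b \<in> borel_measurable N"
    and diff: "\<And>w. w \<in> space N \<Longrightarrow> (\<lambda>b. f b w) differentiable (at b)"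
  shows "(\<lambda>w. partial_deriv v (\<lambda>b. f b w) b) \<in> borel_measurable N"
proof -
  obtain e where e: "e > 0" "ball b e \<subseteq> T" using T open_contains_ball by metis
  \<comment> \<open>The offset 2 keeps even the first step strictly below \<open>e\<close>, so the
    shifted point lies in the open ball.\<close>
  define h where "h k = e / real (k + 2)" for k
  have h: "0 < h k" "h k < e" for k
    using e(1) by (auto simp: h_def field_simps intro: add_pos_nonneg)
  have h0: "h \<longlonglongrightarrow> 0" unfolding h_def
    by (intro LIMSEQ_ignore_initial_segment lim_const_over_n)
  show ?thesis
  proof (rule borel_measurable_LIMSEQ_real)
    fix k
    have "b + h k *\<^sub>R axis v 1 \<in> T" using e(2) h[of k] by (auto simp: dist_norm subset_iff)
    then show "(\<lambda>w. (f (b + h k *\<^sub>R axis v 1) w - f b w) / h k) \<in> borel_measurable N"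
      using meas T(2) by measurable
  next
    fix w assume "w \<in> space N"
    let ?D = "frechet_derivative (\<lambda>b. f b w) (at b)"
    have D: "((\<lambda>b. f b w) has_derivative ?D) (at b)"
      using diff[OF \<open>w \<in> space N\<close>] by (simp add: frechet_derivative_works[symmetric])
    then interpret D: linear ?D by (rule has_derivative_linear)
    have "((\<lambda>t. b + t *\<^sub>R axis v 1) has_derivative (\<lambda>t. t *\<^sub>R axis v 1)) (at 0)"
      by (auto intro!: derivative_eq_intros)
    from has_derivative_compose[OF this, of "\<lambda>b. f b w" ?D] D
    have "((\<lambda>t. f (b + t *\<^sub>R axis v 1) w) has_derivative (\<lambda>t. ?D (t *\<^sub>R axis v 1))) (at 0)"
      by simp
    moreover have "(\<lambda>t. ?D (t *\<^sub>R axis v 1)) = (*) (?D (axis v 1))"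
      by (auto simp: D.scaleR)
    ultimately have "((\<lambda>t. f (b + t *\<^sub>R axis v 1) w) has_field_derivative ?D (axis v 1)) (at 0)"
      by (simp only: has_field_derivative_def)
    then have "((\<lambda>t. (f (b + t *\<^sub>R axis v 1) w - f b w) / t) \<longlongrightarrow> ?D (axis v 1)) (at 0)"
      by (simp add: has_field_derivative_iff)
    moreover have "filterlim h (at 0) sequentially"
      using h0 h(1) by (auto simp: filterlim_at less_imp_neq[symmetric])
    ultimately show "(\<lambda>k. (f (b + h k *\<^sub>R axis v 1) w - f b w) / h k) \<longlonglongrightarrow> partial_deriv v (\<lambda>b. f b w) b"
      unfolding partial_deriv_def by (rule filterlim_compose)
  qed
qed

lemma sq_integrable_cong:
  "(\<And>w. w \<in> space Q \<Longrightarrow> f w = g w) \<Longrightarrow> sq_integrable Q f \<longleftrightarrow> sq_integrable Q g"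
  unfolding sq_integrable_def
  by (intro arg_cong2[of _ _ _ _ "(\<and>)"] measurable_cong Bochner_Integration.integrable_cong) auto


section \<open>Predictable linear combinations of the residuals\<close>

context longitudinal_model
begin

abbreviation "res \<equiv> resid y X mu"

section \<open>Past sigma-algebras and conditional moments of the residuals\<close>

lemma space_past [simp]: "space (past M y i) = space M"
  by (simp add: past_def space_measure_of_conv)

lemma past_generators: "(\<Union>k\<in>{1..i}. {y k -` B \<inter> space M | B. B \<in> sets borel}) \<subseteq> Pow (space M)"
  by auto

lemma sets_past: "sets (past M y i) =
    sigma_sets (space M) (\<Union>k\<in>{1..i}. {y k -` B \<inter> space M | B. B \<in> sets borel})"
  unfolding past_def using past_generators by (rule sets_measure_of)

lemma subalgebra_past:
  assumes "b \<in> T"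
  shows "subalgebra (P b) (past M y i)"
proof -
  have "(\<Union>k\<in>{1..i}. {y k -` B \<inter> space M | B. B \<in> sets borel}) \<subseteq> sets M"
    using y_measurable by (auto intro: measurable_sets)
  then have "sets (past M y i) \<subseteq> sets M" unfolding sets_past by (rule sets.sigma_sets_subset)
  then show ?thesis using assms by (simp add: subalgebra_def space_P sets_P)
qed

lemma borel_measurable_past_mono:
  assumes "f \<in> borel_measurable (past M y i)" "i \<le> i'"
  shows "f \<in> borel_measurable (past M y i')"
proof -
  have "sets (past M y i) \<subseteq> sets (past M y i')"
    unfolding sets_past using assms(2) by (intro sigma_sets_subseteq UN_mono) auto
  then show ?thesis using assms(1) by (intro measurable_from_subalg[of "past M y i'" "past M y i"]) (auto simp: subalgebra_def)
qed

lemma y_measurable_past: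
  assumes "1 \<le> k" "k \<le> i"
  shows "y k \<in> borel_measurable (past M y i)"
proof (rule measurableI)
  fix B assume "B \<in> sets (borel :: (real^'m) measure)"
  then show "y k -` B \<inter> space (past M y i) \<in> sets (past M y i)"
    unfolding sets_past using assms by (intro sigma_sets.Basic UN_I[of k]) auto
qed simp

lemma resid_measurable_past:
  assumes "1 \<le> k" "k \<le> i"
  shows "(\<lambda>w. res k b w $ j) \<in> borel_measurable (past M y i)"
proof -
  note y_measurable_past[OF assms, measurable]
  have "(\<lambda>w. res k b w $ j) = (\<lambda>w. y k w \<bullet> axis j 1 - mu_vec X mu k b $ j)"
    by (simp add: resid_def cart_eq_inner_axis inner_diff_left)
  then show ?thesis by simp
qed

lemma past_measurable_P:
  "b \<in> T \<Longrightarrow> f \<in> borel_measurable (past M y i) \<Longrightarrow> f \<in> borel_measurable (P b)"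
  using measurable_from_subalg[OF subalgebra_past] .

lemma resid_measurable:
  assumes "b \<in> T" "1 \<le> i"
  shows "(\<lambda>w. res i b w $ j) \<in> borel_measurable (P b)"
  using past_measurable_P[OF assms(1) resid_measurable_past[OF assms(2) order_refl]] .

lemma prob_P_subalgebra: "b \<in> T \<Longrightarrow> sigma_finite_subalgebra (P b) (past M y i)"
  using prob_P[of b] subalgebra_past[of b i]
  by (intro finite_measure_subalgebra_is_sigma_finite)
    (simp add: finite_measure_subalgebra_def finite_measure_subalgebra_axioms_def prob_space_def)

lemma resid_sq_integrable:
  assumes b: "b \<in> T" and i: "1 \<le> i"
  shows "sq_integrable (P b) (\<lambda>w. res i b w $ j)"
proof -
  interpret prob_space "P b" using b by (rule prob_P)
  have "(\<lambda>w. y i w $ j) \<in> borel_measurable (P b)"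
    using y_integrable[OF b i] by (rule borel_measurable_integrable)
  then have "sq_integrable (P b) (\<lambda>w. y i w $ j)"
    using y_sq_integrable[OF b i] by (simp add: sq_integrable_def)
  moreover have "sq_integrable (P b) (\<lambda>w. - mu_vec X mu i b $ j)"
    by (simp add: sq_integrable_def)
  ultimately show ?thesis
    using sq_integrable_add by (fastforce simp: resid_def)
qed

lemma cond_mean_resid:
  assumes b: "b \<in> T" and i: "1 \<le> i"
  shows "AE w in P b. real_cond_exp (P b) (past M y (i - 1)) (\<lambda>w. res i b w $ j) w = 0"
proof -
  interpret prob_space "P b" using b by (rule prob_P)
  interpret sigma_finite_subalgebra "P b" "past M y (i - 1)" using b by (rule prob_P_subalgebra)
  have "AE w in P b. real_cond_exp (P b) (past M y (i - 1)) (\<lambda>w. y i w $ j - mu_vec X mu i b $ j) w =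
      real_cond_exp (P b) (past M y (i - 1)) (\<lambda>w. y i w $ j) w -
      real_cond_exp (P b) (past M y (i - 1)) (\<lambda>w. mu_vec X mu i b $ j) w"
    using y_integrable[OF b i] by (intro real_cond_exp_diff) auto
  moreover have "AE w in P b. real_cond_exp (P b) (past M y (i - 1)) (\<lambda>w. mu_vec X mu i b $ j) w
      = mu_vec X mu i b $ j"
    by (intro real_cond_exp_F_meas) auto
  ultimately show ?thesis
    using cond_mean[OF b i, of j] by eventually_elim (simp add: resid_def)
qed

text \<open>The predictable factor is taken out of the conditional expectation, and what remains has
  conditional mean zero. Integrability is asked of the product, which is the form in which it is
  known for the derivative terms of the Jacobian.\<close>

lemma integral_past_mult_resid:
  assumes b: "b \<in> T" and i: "1 \<le> i" and Z: "Z \<in> borel_measurable (past M y (i - 1))"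
    and int: "integrable (P b) (\<lambda>w. Z w * res i b w $ j)"
  shows "(\<integral>w. Z w * res i b w $ j \<partial>P b) = 0"
proof -
  interpret sigma_finite_subalgebra "P b" "past M y (i - 1)" using b by (rule prob_P_subalgebra)
  have "(\<integral>w. Z w * res i b w $ j \<partial>P b) =
      (\<integral>w. Z w * real_cond_exp (P b) (past M y (i - 1)) (\<lambda>w. res i b w $ j) w \<partial>P b)"
    using real_cond_exp_intg(2)[OF int Z resid_measurable[OF b i]] by simp
  also have "\<dots> = 0"
    using cond_mean_resid[OF b i, of j] by (intro integral_eq_zero_AE) auto
  finally show ?thesis .
qed

lemma integral_past_mult_resid2:
  assumes b: "b \<in> T" and i: "1 \<le> i" and Z: "Z \<in> borel_measurable (past M y (i - 1))"
    and int: "integrable (P b) (\<lambda>w. Z w * (res i b w $ j * res i b w $ k))"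
  shows "integrable (P b) (\<lambda>w. Z w * Sc i b w $ j $ k)"
    and "(\<integral>w. Z w * (res i b w $ j * res i b w $ k) \<partial>P b) = (\<integral>w. Z w * Sc i b w $ j $ k \<partial>P b)"
proof -
  interpret sigma_finite_subalgebra "P b" "past M y (i - 1)" using b by (rule prob_P_subalgebra)
  have m [measurable]: "(\<lambda>w. res i b w $ j * res i b w $ k) \<in> borel_measurable (P b)"
    using resid_measurable[OF b i] by measurable
  have [measurable]: "Z \<in> borel_measurable (P b)"
    "(\<lambda>w. Sc i b w $ j $ k) \<in> borel_measurable (P b)"
    using past_measurable_P[OF b] Z Sc_measurable[OF b i] by blast+
  let ?E = "real_cond_exp (P b) (past M y (i - 1)) (\<lambda>w. res i b w $ j * res i b w $ k)"
  have [measurable]: "?E \<in> borel_measurable (P b)" by (rule borel_measurable_cond_exp2)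
  have AE: "AE w in P b. Z w * ?E w = Z w * Sc i b w $ j $ k"
    using Sc_version[OF b i, of j k] by eventually_elim simp
  note E = real_cond_exp_intg[OF int Z m]
  show "integrable (P b) (\<lambda>w. Z w * Sc i b w $ j $ k)"
    using E(1) integrable_cong_AE[THEN iffD1, OF _ _ AE] by simp
  show "(\<integral>w. Z w * (res i b w $ j * res i b w $ k) \<partial>P b) = (\<integral>w. Z w * Sc i b w $ j $ k \<partial>P b)"
    unfolding E(2)[symmetric] using AE by (intro integral_cong_AE) auto
qed

lemma Sc_symmetric:
  assumes "b \<in> T" "1 \<le> i"
  shows "AE w in P b. Sc i b w $ j $ k = Sc i b w $ k $ j"
  using Sc_version[OF assms, of j k] Sc_version[OF assms, of k j]
  by eventually_elim (simp add: mult.commute)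

text \<open>\<open>cond_var\<close> centres at the conditional expectation and \<open>Sc\<close> at
  the model mean; the two centres agree almost surely.\<close>

lemma Sc_diagonal:
  assumes b: "b \<in> T" and i: "1 \<le> i"
  shows "AE w in P b. Sc i b w $ j $ j = sigma2 X mu i b $ j"
proof -
  interpret sigma_finite_subalgebra "P b" "past M y (i - 1)" using b by (rule prob_P_subalgebra)
  let ?E = "real_cond_exp (P b) (past M y (i - 1))"
  note [measurable] = resid_measurable[OF b i, of j] borel_measurable_integrable[OF y_integrable[OF b i, of j]]
  have "AE w in P b. ?E (\<lambda>w. (y i w $ j - ?E (\<lambda>w. y i w $ j) w)\<^sup>2) w = ?E (\<lambda>w. res i b w $ j * res i b w $ j) w"
  proof (rule real_cond_exp_cong)
    show "AE w in P b. (y i w $ j - ?E (\<lambda>w. y i w $ j) w)\<^sup>2 = res i b w $ j * res i b w $ j"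
      using cond_mean[OF b i, of j] by eventually_elim (simp add: resid_def power2_eq_square)
  qed measurable
  then show ?thesis using Sc_version[OF b i, of j j] cond_variance[OF b i, of j]
    unfolding cond_var_def by eventually_elim simp
qed

lemma sigma2_pos: "0 < sigma2 X mu i b $ j"
  by (simp add: sigma2_def mu_deriv_pos)

text \<open>Conditioning on the past turns the second moment into \<open>sigma2\<close> times that
  of \<open>c\<close>. Its finiteness is the claim, so the real conditional expectation cannot be
  applied to the product yet; the argument runs with the nonnegative one instead.\<close>

lemma past_mult_resid_sq_integrable:
  assumes b: "b \<in> T" and i: "1 \<le> i" and c: "c \<in> borel_measurable (past M y (i - 1))"
    and sq: "sq_integrable (P b) c"
  shows "sq_integrable (P b) (\<lambda>w. c w * res i b w $ j)"
proof -
  interpret prob_space "P b" using b by (rule prob_P)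
  interpret sigma_finite_subalgebra "P b" "past M y (i - 1)" using b by (rule prob_P_subalgebra)
  let ?r = "\<lambda>w. res i b w $ j" and ?s = "sigma2 X mu i b $ j"
  note [measurable] = resid_measurable[OF b i, of j] c past_measurable_P[OF b c]
  have r2: "integrable (P b) (\<lambda>w. (?r w)\<^sup>2)" using resid_sq_integrable[OF b i] by (simp add: sq_integrable_def)
  \<comment> \<open>The conditional expectation is identified by testing on past events: with an
    indicator as factor integrability is clear, and the real-valued identity for \<open>Sc\<close>
    applies.\<close>
  have AE: "AE w in P b. ennreal ?s = nn_cond_exp (P b) (past M y (i - 1)) (\<lambda>w. ennreal ((?r w)\<^sup>2)) w"
  proof (rule nn_cond_exp_charact)
    fix A assume A: "A \<in> sets (past M y (i - 1))"
    then have [measurable]: "A \<in> sets (P b)" using subalgebra_past[OF b] by (auto simp: subalgebra_def)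
    have m: "indicator A \<in> borel_measurable (past M y (i - 1))" using A by simp
    have int: "integrable (P b) (\<lambda>w. indicator A w * (?r w * ?r w))"
      using integrable_mult_indicator[of A "P b" "\<lambda>w. ?r w * ?r w"] r2
      by (simp add: power2_eq_square)
    have "(\<integral>\<^sup>+w\<in>A. ennreal ((?r w)\<^sup>2) \<partial>P b) = (\<integral>\<^sup>+w. ennreal (indicator A w * (?r w * ?r w)) \<partial>P b)"
      by (intro nn_integral_cong) (simp add: indicator_def power2_eq_square)
    also have "\<dots> = ennreal (\<integral>w. indicator A w * (?r w * ?r w) \<partial>P b)"
      by (rule nn_integral_eq_integral[OF int]) auto
    also have "\<dots> = ennreal (\<integral>w. indicator A w * Sc i b w $ j $ j \<partial>P b)"
      using integral_past_mult_resid2(2)[OF b i m int] by simp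
    also have "\<dots> = (\<integral>\<^sup>+w. ennreal (indicator A w * Sc i b w $ j $ j) \<partial>P b)"
      using Sc_diagonal[OF b i, of j] sigma2_pos[of i b j]
      by (intro nn_integral_eq_integral[symmetric] integral_past_mult_resid2(1)[OF b i m int])
        (auto elim!: eventually_mono simp: less_imp_le)
    also have "\<dots> = (\<integral>\<^sup>+w\<in>A. ennreal ?s \<partial>P b)"
      using Sc_diagonal[OF b i, of j]
      by (intro nn_integral_cong_AE) (auto elim!: eventually_mono simp: indicator_def)
    finally show "(\<integral>\<^sup>+w\<in>A. ennreal ((?r w)\<^sup>2) \<partial>P b) = (\<integral>\<^sup>+w\<in>A. ennreal ?s \<partial>P b)" .
  qed auto
  have "(\<integral>\<^sup>+w. ennreal ((c w)\<^sup>2) * ennreal ((?r w)\<^sup>2) \<partial>P b) =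
      (\<integral>\<^sup>+w. ennreal ((c w)\<^sup>2) * nn_cond_exp (P b) (past M y (i - 1)) (\<lambda>w. ennreal ((?r w)\<^sup>2)) w \<partial>P b)"
    by (rule nn_cond_exp_intg[symmetric]) measurable
  also have "\<dots> = (\<integral>\<^sup>+w. ennreal ((c w)\<^sup>2) * ennreal ?s \<partial>P b)"
    using AE by (intro nn_integral_cong_AE) (auto elim!: eventually_mono)
  also have "\<dots> = (\<integral>\<^sup>+w. ennreal ((c w)\<^sup>2 * ?s) \<partial>P b)"
    using sigma2_pos[of i b j] by (simp add: ennreal_mult less_imp_le)
  also have "\<dots> < \<infinity>"
    using sq sigma2_pos[of i b j] integrable_mult_left[of ?s "P b" "\<lambda>w. (c w)\<^sup>2"]
    by (subst nn_integral_eq_integral) (auto simp: sq_integrable_def less_imp_le)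
  finally have "(\<integral>\<^sup>+w. ennreal (norm ((c w * ?r w)\<^sup>2)) \<partial>P b) < \<infinity>"
    by (simp add: power_mult_distrib ennreal_mult)
  then show ?thesis by (simp add: sq_integrable_def integrable_iff_bounded)
qed

section \<open>Square integrable martingale transforms of the residuals\<close>

definition predictable_sq :: "real^'p \<Rightarrow> nat \<Rightarrow> (nat \<Rightarrow> 'w \<Rightarrow> real^'m) \<Rightarrow> bool" where
  "predictable_sq b n c \<longleftrightarrow> (\<forall>i\<in>{1..n}. \<forall>j. (\<lambda>w. c i w $ j) \<in> borel_measurable (past M y (i - 1))
     \<and> sq_integrable (P b) (\<lambda>w. c i w $ j))"

text \<open>A scalar martingale transform. Vector-valued estimating functions enter through
  \<open>a \<bullet> q\<close>, each of which is one such sum.\<close>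

definition score :: "real^'p \<Rightarrow> nat \<Rightarrow> (nat \<Rightarrow> 'w \<Rightarrow> real^'m) \<Rightarrow> 'w \<Rightarrow> real" where
  "score b n c w = (\<Sum>i=1..n. c i w \<bullet> res i b w)"

lemma score_term_sq_integrable:
  assumes "b \<in> T" "predictable_sq b n c" "i \<in> {1..n}"
  shows "sq_integrable (P b) (\<lambda>w. c i w \<bullet> res i b w)"
  using assms by (auto simp: inner_vec_def predictable_sq_def
      intro!: sq_integrable_sum past_mult_resid_sq_integrable)

lemma score_sq_integrable:
  assumes "b \<in> T" "predictable_sq b n c"
  shows "sq_integrable (P b) (score b n c)"
  unfolding score_def using score_term_sq_integrable[OF assms] by (intro sq_integrable_sum)

lemma score_mean:
  assumes b: "b \<in> T" and c: "predictable_sq b n c"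
  shows "(\<integral>w. score b n c w \<partial>P b) = 0"
proof -
  interpret prob_space "P b" using b by (rule prob_P)
  have int: "integrable (P b) (\<lambda>w. c i w $ j * res i b w $ j)" if "i \<in> {1..n}" for i j
    using that c by (intro sq_integrable_imp_integrable past_mult_resid_sq_integrable b)
      (auto simp: predictable_sq_def)
  have "(\<integral>w. score b n c w \<partial>P b) = (\<Sum>i=1..n. \<Sum>j\<in>UNIV. \<integral>w. c i w $ j * res i b w $ j \<partial>P b)"
    using int by (simp add: score_def inner_vec_def)
  also have "\<dots> = 0"
    using int c by (intro sum.neutral ballI integral_past_mult_resid b) (auto simp: predictable_sq_def)
  finally show ?thesis .
qed

text \<open>The whole term of individual \<open>i\<close> and the coefficient \<open>d k\<close> are
  known before \<open>k\<close> is observed, so the residual of \<open>k\<close> is multiplied by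
  past-measurable variables only.\<close>

lemma integral_score_terms_distinct:
  assumes b: "b \<in> T" and c: "predictable_sq b n c" and d: "predictable_sq b n d"
    and i: "i \<in> {1..n}" and k: "k \<in> {1..n}" and ik: "i < k"
  shows "(\<integral>w. (c i w \<bullet> res i b w) * (d k w \<bullet> res k b w) \<partial>P b) = 0"
proof -
  have sq: "sq_integrable (P b) (\<lambda>w. d k w $ j * res k b w $ j)" for j
    using d k by (intro past_mult_resid_sq_integrable b) (auto simp: predictable_sq_def)
  have int: "integrable (P b) (\<lambda>w. ((c i w \<bullet> res i b w) * d k w $ j) * res k b w $ j)" for j
    using sq_integrable_mult[OF score_term_sq_integrable[OF b c i] sq[of j]] by (simp add: mult.assoc)
  have "(\<lambda>w. c i w $ j) \<in> borel_measurable (past M y (k - 1))" for j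
    using c i ik by (intro borel_measurable_past_mono[of _ "i - 1" "k - 1"]) (auto simp: predictable_sq_def)
  moreover have "(\<lambda>w. res i b w $ j) \<in> borel_measurable (past M y (k - 1))" for j
    using i ik by (intro resid_measurable_past) auto
  ultimately have "(\<lambda>w. c i w \<bullet> res i b w) \<in> borel_measurable (past M y (k - 1))"
    unfolding inner_vec_def inner_real_def by (intro borel_measurable_sum borel_measurable_times)
  then have meas: "(\<lambda>w. (c i w \<bullet> res i b w) * d k w $ j) \<in> borel_measurable (past M y (k - 1))" for j
    using d k by (intro borel_measurable_times) (auto simp: predictable_sq_def)
  have "(\<integral>w. (c i w \<bullet> res i b w) * (d k w \<bullet> res k b w) \<partial>P b) =
      (\<integral>w. (\<Sum>j\<in>UNIV. ((c i w \<bullet> res i b w) * d k w $ j) * res k b w $ j) \<partial>P b)"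
    by (simp add: inner_vec_def[of "d k _"] sum_distrib_left mult.assoc)
  also have "\<dots> = (\<Sum>j\<in>UNIV. \<integral>w. ((c i w \<bullet> res i b w) * d k w $ j) * res k b w $ j \<partial>P b)"
    using int by (intro Bochner_Integration.integral_sum) auto
  also have "\<dots> = 0"
    using k by (intro sum.neutral ballI integral_past_mult_resid b meas int) auto
  finally show ?thesis .
qed

lemma integral_score_term:
  assumes b: "b \<in> T" and c: "predictable_sq b n c" and d: "predictable_sq b n d"
    and i: "i \<in> {1..n}"
  shows "integrable (P b) (\<lambda>w. c i w \<bullet> (Sc i b w *v d i w))"
    and "(\<integral>w. (c i w \<bullet> res i b w) * (d i w \<bullet> res i b w) \<partial>P b) =
      (\<integral>w. c i w \<bullet> (Sc i b w *v d i w) \<partial>P b)"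
proof -
  have i1: "1 \<le> i" using i by simp
  have sq: "sq_integrable (P b) (\<lambda>w. d i w $ j * res i b w $ j)"
    "sq_integrable (P b) (\<lambda>w. c i w $ j * res i b w $ j)" for j
    using c d i by (auto intro!: past_mult_resid_sq_integrable b simp: predictable_sq_def)
  have int: "integrable (P b) (\<lambda>w. (c i w $ j * d i w $ k) * (res i b w $ j * res i b w $ k))" for j k
    using sq_integrable_mult[OF sq(2)[of j] sq(1)[of k]] by (simp add: mult_ac)
  have meas: "(\<lambda>w. c i w $ j * d i w $ k) \<in> borel_measurable (past M y (i - 1))" for j k
    using c d i by (intro borel_measurable_times) (auto simp: predictable_sq_def)
  note E = integral_past_mult_resid2[OF b i1 meas int]
  have form: "c i w \<bullet> (Sc i b w *v d i w) =
      (\<Sum>j\<in>UNIV. \<Sum>k\<in>UNIV. (c i w $ j * d i w $ k) * Sc i b w $ j $ k)" for w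
    by (simp add: inner_vec_def matrix_vector_mult_def sum_distrib_left mult_ac)
  show "integrable (P b) (\<lambda>w. c i w \<bullet> (Sc i b w *v d i w))"
    unfolding form by (intro Bochner_Integration.integrable_sum E)
  have "(\<integral>w. (c i w \<bullet> res i b w) * (d i w \<bullet> res i b w) \<partial>P b) =
      (\<integral>w. (\<Sum>j\<in>UNIV. \<Sum>k\<in>UNIV. (c i w $ j * d i w $ k) * (res i b w $ j * res i b w $ k)) \<partial>P b)"
    by (simp add: inner_vec_def sum_product mult_ac)
  also have "\<dots> = (\<Sum>j\<in>UNIV. \<Sum>k\<in>UNIV. \<integral>w. (c i w $ j * d i w $ k) * (res i b w $ j * res i b w $ k) \<partial>P b)"
    using int by simp
  also have "\<dots> = (\<Sum>j\<in>UNIV. \<Sum>k\<in>UNIV. \<integral>w. (c i w $ j * d i w $ k) * Sc i b w $ j $ k \<partial>P b)"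
    by (simp only: E(2))
  also have "\<dots> = (\<integral>w. c i w \<bullet> (Sc i b w *v d i w) \<partial>P b)"
    unfolding form using E(1) by simp
  finally show "(\<integral>w. (c i w \<bullet> res i b w) * (d i w \<bullet> res i b w) \<partial>P b) =
      (\<integral>w. c i w \<bullet> (Sc i b w *v d i w) \<partial>P b)" .
qed

text \<open>Orthogonality of martingale differences leaves the diagonal terms; pairs with
  \<open>k < i\<close> follow by exchanging \<open>c\<close> and \<open>d\<close>.\<close>

lemma integral_score_mult:
  assumes b: "b \<in> T" and c: "predictable_sq b n c" and d: "predictable_sq b n d"
  shows "(\<integral>w. score b n c w * score b n d w \<partial>P b) = (\<Sum>i=1..n. \<integral>w. c i w \<bullet> (Sc i b w *v d i w) \<partial>P b)"
proof -
  have int: "integrable (P b) (\<lambda>w. (c i w \<bullet> res i b w) * (d k w \<bullet> res k b w))"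
    if "i \<in> {1..n}" "k \<in> {1..n}" for i k
    using that c d by (intro sq_integrable_mult score_term_sq_integrable[OF b])
  have "(\<integral>w. score b n c w * score b n d w \<partial>P b) =
      (\<Sum>i=1..n. \<Sum>k=1..n. \<integral>w. (c i w \<bullet> res i b w) * (d k w \<bullet> res k b w) \<partial>P b)"
    unfolding score_def sum_product
    by (subst Bochner_Integration.integral_sum)
      (intro sum.cong refl Bochner_Integration.integral_sum Bochner_Integration.integrable_sum int; assumption)+
  also have "\<dots> = (\<Sum>i=1..n. \<Sum>k=1..n. if k = i then \<integral>w. c i w \<bullet> (Sc i b w *v d i w) \<partial>P b else 0)"
  proof (intro sum.cong refl)
    fix i k assume ik: "i \<in> {1..n}" "k \<in> {1..n}"
    consider "i < k" | "k < i" | "k = i" by linarith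
    then show "(\<integral>w. (c i w \<bullet> res i b w) * (d k w \<bullet> res k b w) \<partial>P b) =
        (if k = i then \<integral>w. c i w \<bullet> (Sc i b w *v d i w) \<partial>P b else 0)"
    proof cases
      case 1 then show ?thesis using integral_score_terms_distinct[OF b c d ik] by simp
    next
      case 2 then show ?thesis using integral_score_terms_distinct[OF b d c ik(2,1)]
        by (simp add: mult.commute)
    next
      case 3 then show ?thesis using integral_score_term(2)[OF b c d ik(1)] by simp
    qed
  qed
  also have "\<dots> = (\<Sum>i=1..n. \<integral>w. c i w \<bullet> (Sc i b w *v d i w) \<partial>P b)"
    by (intro sum.cong refl) simp
  finally show ?thesis .
qed

section \<open>The expected Jacobian of an estimating function\<close>

lemma mu_link_has_derivative:
  "((\<lambda>b. mu (x \<bullet> b)) has_derivative (\<lambda>h. deriv mu (x \<bullet> b) * (x \<bullet> h))) (at b)"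
proof -
  have "(mu has_field_derivative deriv mu (x \<bullet> b)) (at (x \<bullet> b))"
    using mu_differentiable by (simp add: DERIV_deriv_iff_real_differentiable)
  then have "(mu has_derivative (\<lambda>h. deriv mu (x \<bullet> b) * h)) (at (x \<bullet> b))"
    by (simp add: has_field_derivative_def)
  moreover have "((\<lambda>b. x \<bullet> b) has_derivative (\<lambda>h. x \<bullet> h)) (at b)"
    by (auto intro!: derivative_eq_intros)
  ultimately show ?thesis using has_derivative_compose by blast
qed

lemma jacobian_estimating_function:
  fixes C :: "nat \<Rightarrow> real^'p \<Rightarrow> 'w \<Rightarrow> real^'m^'p"
  assumes b: "b \<in> T"
    and q: "\<And>b. b \<in> T \<Longrightarrow> q b w = (\<Sum>i=1..n. C i b w *v res i b w)"
    and diff: "\<And>i u j. i \<in> {1..n} \<Longrightarrow> (\<lambda>b. C i b w $ u $ j) differentiable (at b)"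
  shows "jacobian (\<lambda>b. q b w) (at b) $ u $ v = (\<Sum>i=1..n. \<Sum>j\<in>UNIV.
    partial_deriv v (\<lambda>b. C i b w $ u $ j) b * res i b w $ j
      - C i b w $ u $ j * (sigma2 X mu i b $ j * X i $ j $ v))"
proof -
  define D where "D i u j = frechet_derivative (\<lambda>b. C i b w $ u $ j) (at b)" for i u j
  have D: "((\<lambda>b. C i b w $ u $ j) has_derivative D i u j) (at b)" if "i \<in> {1..n}" for i u j
    using diff[OF that] by (simp add: D_def frechet_derivative_works[symmetric])
  define q' where "q' h = (\<chi> u. \<Sum>i=1..n. \<Sum>j\<in>UNIV. D i u j h * res i b w $ j
      - C i b w $ u $ j * (sigma2 X mu i b $ j * (X i $ j \<bullet> h)))" for h
  have comp: "((\<lambda>b. \<Sum>i=1..n. \<Sum>j\<in>UNIV. C i b w $ u $ j * res i b w $ j) has_derivative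
      (\<lambda>h. q' h $ u)) (at b)" for u
  proof -
    have r: "((\<lambda>b. res i b w $ j) has_derivative (\<lambda>h. - (sigma2 X mu i b $ j * (X i $ j \<bullet> h)))) (at b)" for i j
      unfolding resid_def mu_vec_def sigma2_def
      using has_derivative_diff[OF has_derivative_const mu_link_has_derivative, of "y i w $ j" "X i $ j" b]
      by simp
    have "((\<lambda>b. \<Sum>i=1..n. \<Sum>j\<in>UNIV. C i b w $ u $ j * res i b w $ j) has_derivative
      (\<lambda>h. \<Sum>i=1..n. \<Sum>j\<in>UNIV. C i b w $ u $ j * - (sigma2 X mu i b $ j * (X i $ j \<bullet> h))
        + D i u j h * res i b w $ j)) (at b)"
      using D r by (intro has_derivative_sum has_derivative_mult)
    then show ?thesis by (simp add: q'_def add.commute[of "- _"])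
  qed
  have "((\<lambda>b. \<Sum>i=1..n. C i b w *v res i b w) has_derivative q') (at b)"
  proof (subst has_derivative_componentwise_within, rule ballI)
    fix e :: "real^'p" assume "e \<in> Basis"
    then obtain u where e: "e = axis u 1" by (auto simp: Basis_vec_def)
    have "(\<Sum>i=1..n. C i b w *v res i b w) \<bullet> e = (\<Sum>i=1..n. \<Sum>j\<in>UNIV. C i b w $ u $ j * res i b w $ j)" for b
      by (simp add: e cart_eq_inner_axis[symmetric] sum_component matrix_vector_mult_def)
    then show "((\<lambda>b. (\<Sum>i=1..n. C i b w *v res i b w) \<bullet> e) has_derivative (\<lambda>h. q' h \<bullet> e)) (at b)"
      using comp[of u] by (simp add: e cart_eq_inner_axis[symmetric])
  qed
  \<comment> \<open>The representation of \<open>q\<close> holds on \<open>T\<close> only, which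
    suffices for the derivative because \<open>T\<close> is open.\<close>
  then have "((\<lambda>b. q b w) has_derivative q') (at b)"
    by (rule has_derivative_transform_within_open[OF _ open_T b]) (simp add: q)
  then have "frechet_derivative (\<lambda>b. q b w) (at b) = q'"
    by (rule frechet_derivative_at[symmetric])
  then show ?thesis
    by (simp add: jacobian_def matrix_def q'_def partial_deriv_def D_def inner_axis)
qed

text \<open>Derivatives of the coefficients are again past-measurable, so their products with the
  residuals have mean zero. What survives is the derivative of the mean, weighted by the expected
  coefficients.\<close>

lemma exp_jacobian_estimating_function:
  fixes C :: "nat \<Rightarrow> real^'p \<Rightarrow> 'w \<Rightarrow> real^'m^'p"
  assumes b: "b \<in> T"
    and q: "\<And>b w. b \<in> T \<Longrightarrow> w \<in> space M \<Longrightarrow> q b w = (\<Sum>i=1..n. C i b w *v res i b w)"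
    and meas: "\<And>b i u j. b \<in> T \<Longrightarrow> i \<in> {1..n} \<Longrightarrow> (\<lambda>w. C i b w $ u $ j) \<in> borel_measurable (past M y (i - 1))"
    and diff: "\<And>w i u j. w \<in> space M \<Longrightarrow> i \<in> {1..n} \<Longrightarrow> (\<lambda>b. C i b w $ u $ j) differentiable (at b)"
    and intC: "\<And>i u j. i \<in> {1..n} \<Longrightarrow> integrable (P b) (\<lambda>w. C i b w $ u $ j)"
    and intD: "\<And>i u v j. i \<in> {1..n} \<Longrightarrow>
      integrable (P b) (\<lambda>w. partial_deriv v (\<lambda>b. C i b w $ u $ j) b * res i b w $ j)"
  shows "exp_jacobian P q b $ u $ v =
    - (\<Sum>i=1..n. \<Sum>j\<in>UNIV. (\<integral>w. C i b w $ u $ j \<partial>P b) * (sigma2 X mu i b $ j * X i $ j $ v))"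
proof -
  have D0: "(\<integral>w. partial_deriv v (\<lambda>b. C i b w $ u $ j) b * res i b w $ j \<partial>P b) = 0"
    if i: "i \<in> {1..n}" for i j
    using i meas diff by (intro integral_past_mult_resid b intD partial_deriv_measurable[OF open_T]) auto
  have "exp_jacobian P q b $ u $ v = (\<integral>w. jacobian (\<lambda>b. q b w) (at b) $ u $ v \<partial>P b)"
    by (simp add: exp_jacobian_def)
  also have "\<dots> = (\<integral>w. (\<Sum>i=1..n. \<Sum>j\<in>UNIV.
    partial_deriv v (\<lambda>b. C i b w $ u $ j) b * res i b w $ j
      - C i b w $ u $ j * (sigma2 X mu i b $ j * X i $ j $ v)) \<partial>P b)"
    using b q diff by (intro Bochner_Integration.integral_cong refl jacobian_estimating_function)
      (auto simp: space_P)
  also have "\<dots> = (\<Sum>i=1..n. \<Sum>j\<in>UNIV. (\<integral>w. partial_deriv v (\<lambda>b. C i b w $ u $ j) b * res i b w $ j \<partial>P b)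
      - (\<integral>w. C i b w $ u $ j \<partial>P b) * (sigma2 X mu i b $ j * X i $ j $ v))"
    using intC intD by simp
  also have "\<dots> = - (\<Sum>i=1..n. \<Sum>j\<in>UNIV. (\<integral>w. C i b w $ u $ j \<partial>P b) * (sigma2 X mu i b $ j * X i $ j $ v))"
    by (simp add: D0 sum_negf)
  finally show ?thesis .
qed

lemma A_mat_mult_vec: "(A_mat X mu i b *v v) $ j = sigma2 X mu i b $ j * v $ j"
  by (simp add: A_mat_def matrix_vector_mult_def if_distrib[of "\<lambda>x. x * _"] cong: if_cong)

text \<open>Extracts from membership in \<open>H_class\<close> what the later argument uses. In
  direction \<open>a\<close> the predictable coefficients are the transposed coefficient matrices
  applied to \<open>a\<close>.\<close>

lemma H_class_representation:
  assumes qH: "q \<in> H_class M P T y X mu Sc n" and b: "b \<in> T"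
  obtains c where "\<And>a. predictable_sq b n (c a)"
    "\<And>a w. w \<in> space M \<Longrightarrow> a \<bullet> q b w = score b n (c a) w"
    "\<And>a l. a \<bullet> (exp_jacobian P q b *v l) =
       - (\<Sum>i=1..n. \<integral>w. c a i w \<bullet> (A_mat X mu i b *v (X i *v l)) \<partial>P b)"
proof -
  obtain C where C: "\<forall>b\<in>T. \<forall>w\<in>space M. q b w = (\<Sum>i=1..n. C i b w *v res i b w)"
     "\<forall>i\<in>{1..n}. \<forall>u j.
        (\<forall>b\<in>T. (\<lambda>w. C i b w $ u $ j) \<in> borel_measurable (past M y (i - 1))) \<and>
        (\<forall>w\<in>space M. cont_differentiable_on (\<lambda>b. C i b w $ u $ j) T)"
     "\<forall>b\<in>T. \<forall>i\<in>{1..n}. \<forall>u v j k.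
        integrable (P b) (\<lambda>w. C i b w $ u $ j) \<and>
        integrable (P b) (\<lambda>w. partial_deriv v (\<lambda>b. C i b w $ u $ j) b * res i b w $ j) \<and>
        integrable (P b) (\<lambda>w. C i b w $ u $ j * Sc i b w $ j $ k * C i b w $ v $ k)"
    using qH unfolding H_class_def by blast
  have q: "q b w = (\<Sum>i=1..n. C i b w *v res i b w)" if "b \<in> T" "w \<in> space M" for b w
    using C(1) that by blast
  have meas: "(\<lambda>w. C i b w $ u $ j) \<in> borel_measurable (past M y (i - 1))" if "b \<in> T" "i \<in> {1..n}" for b i u j
    using C(2) that by blast
  have cd: "cont_differentiable_on (\<lambda>b. C i b w $ u $ j) T" if "w \<in> space M" "i \<in> {1..n}" for w i u j
    using C(2) that by blast
  have intC: "integrable (P b) (\<lambda>w. C i b w $ u $ j)"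
    and intD: "integrable (P b) (\<lambda>w. partial_deriv v (\<lambda>b. C i b w $ u $ j) b * res i b w $ j)"
    and intV: "integrable (P b) (\<lambda>w. C i b w $ u $ j * Sc i b w $ j $ k * C i b w $ v $ k)"
    if "i \<in> {1..n}" for i u v j k
    using C(3) b that by blast+
  have diff: "(\<lambda>b. C i b w $ u $ j) differentiable (at b)" if "w \<in> space M" "i \<in> {1..n}" for w i u j
    using cd[OF that, of u j] b unfolding cont_differentiable_on_def differentiable_def by blast
  \<comment> \<open>The case \<open>u = v\<close>, \<open>j = k\<close> of the third integrability
    condition: there \<open>Sc\<close> equals the positive constant \<open>?s\<close> almost surely,
    so the squared coefficient is integrable.\<close>
  have sq: "sq_integrable (P b) (\<lambda>w. C i b w $ u $ j)" if i: "i \<in> {1..n}" for i u j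
  proof -
    let ?s = "sigma2 X mu i b $ j"
    have [measurable]: "(\<lambda>w. C i b w $ u $ j) \<in> borel_measurable (P b)"
      using intC[OF i] by (rule borel_measurable_integrable)
    have [measurable]: "(\<lambda>w. Sc i b w $ j $ j) \<in> borel_measurable (P b)"
      using i Sc_measurable[OF b] by (intro past_measurable_P[OF b]) auto
    have "AE w in P b. C i b w $ u $ j * Sc i b w $ j $ j * C i b w $ u $ j = ?s * (C i b w $ u $ j)\<^sup>2"
      using Sc_diagonal[OF b, of i j] i by (auto elim!: eventually_mono simp: power2_eq_square)
    then have "integrable (P b) (\<lambda>w. ?s * (C i b w $ u $ j)\<^sup>2)"
      using intV[OF i, of u j j u] by (subst (asm) integrable_cong_AE) auto
    then show ?thesis using sigma2_pos[of i b j] by (simp add: sq_integrable_def)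
  qed
  define c where "c a i w = transpose (C i b w) *v a" for a i w
  have cj: "c a i w $ j = (\<Sum>u\<in>UNIV. C i b w $ u $ j * a $ u)" for a i w j
    by (simp add: c_def matrix_vector_mult_def transpose_def)
  show thesis
  proof
    show "predictable_sq b n (c a)" for a
      unfolding predictable_sq_def cj using meas[OF b] sq
      by (auto intro!: sq_integrable_sum sq_integrable_scale borel_measurable_sum borel_measurable_times)
    show "a \<bullet> q b w = score b n (c a) w" if "w \<in> space M" for a w
      unfolding q[OF b that] score_def c_def inner_sum_right
      by (intro sum.cong refl) (metis dot_lmul_matrix transpose_matrix_vector)
    fix a l
    have int: "integrable (P b) (\<lambda>w. C i b w $ u $ j * a $ u)" if "i \<in> {1..n}" for i u j
      using intC[OF that] by simp
    have "(\<integral>w. c a i w \<bullet> (A_mat X mu i b *v (X i *v l)) \<partial>P b) =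
       (\<Sum>j\<in>UNIV. (\<Sum>u\<in>UNIV. (\<integral>w. C i b w $ u $ j \<partial>P b) * a $ u) * (sigma2 X mu i b $ j * (X i *v l) $ j))"
      if i: "i \<in> {1..n}" for i
      unfolding inner_vec_def[of "c _ _ _"] cj A_mat_mult_vec using int[OF i] by simp
    then have "- (\<Sum>i=1..n. \<integral>w. c a i w \<bullet> (A_mat X mu i b *v (X i *v l)) \<partial>P b) =
      - (\<Sum>i=1..n. \<Sum>j\<in>UNIV. \<Sum>u\<in>UNIV. \<Sum>v\<in>UNIV.
         a $ u * ((\<integral>w. C i b w $ u $ j \<partial>P b) * (sigma2 X mu i b $ j * X i $ j $ v)) * l $ v)"
      by (simp add: matrix_vector_mult_def sum_distrib_left sum_distrib_right mult_ac)
        (rule sum.cong[OF refl], rule sum.cong[OF refl], rule sum.swap)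
    also have "\<dots> = a \<bullet> (exp_jacobian P q b *v l)"
    proof -
      have "a \<bullet> (exp_jacobian P q b *v l) = - (\<Sum>u\<in>UNIV. \<Sum>v\<in>UNIV. \<Sum>i=1..n. \<Sum>j\<in>UNIV.
         a $ u * ((\<integral>w. C i b w $ u $ j \<partial>P b) * (sigma2 X mu i b $ j * X i $ j $ v)) * l $ v)"
        unfolding inner_vec_def matrix_vector_mult_def
        using exp_jacobian_estimating_function[OF b q meas diff intC intD]
        by (simp add: sum_distrib_left sum_distrib_right sum_negf mult_ac)
      also have "\<dots> = - (\<Sum>i=1..n. \<Sum>j\<in>UNIV. \<Sum>u\<in>UNIV. \<Sum>v\<in>UNIV.
         a $ u * ((\<integral>w. C i b w $ u $ j \<partial>P b) * (sigma2 X mu i b $ j * X i $ j $ v)) * l $ v)"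
        by (simp only: sum.swap[of _ "{1..n}" "UNIV :: 'p set"] sum.swap[of _ "UNIV :: 'm set" "UNIV :: 'p set"])
      finally show ?thesis by simp
    qed
    finally show "a \<bullet> (exp_jacobian P q b *v l) =
       - (\<Sum>i=1..n. \<integral>w. c a i w \<bullet> (A_mat X mu i b *v (X i *v l)) \<partial>P b)" by simp
  qed
qed


section \<open>Working correlations\<close>

abbreviation sqrtA :: "nat \<Rightarrow> real^'p \<Rightarrow> real^'m^'m" where
  "sqrtA i b \<equiv> mat_sqrt (A_mat X mu i b)"

abbreviation isqrtA :: "nat \<Rightarrow> real^'p \<Rightarrow> real^'m^'m" where
  "isqrtA i b \<equiv> mat_inv_sqrt (A_mat X mu i b)"

lemma diagonal_mult_vec:
  fixes d :: "'m \<Rightarrow> real"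
  shows "((\<chi> j k. if j = k then d j else 0) *v v) $ j = d j * v $ j"
  by (simp add: matrix_vector_mult_def if_distrib[of "\<lambda>x. x * _"] cong: if_cong)

lemma A_mat_pos_def: "pos_def_mat (A_mat X mu i b)"
  unfolding pos_def_mat_def
proof (intro conjI allI impI)
  show "symmetric_mat (A_mat X mu i b)"
    by (rule symmetric_matI) (simp add: inner_vec_def A_mat_mult_vec mult_ac)
  fix v :: "real^'m" assume "v \<noteq> 0"
  then obtain j where j: "v $ j \<noteq> 0" by (auto simp: vec_eq_iff)
  have "v \<bullet> (A_mat X mu i b *v v) = (\<Sum>j\<in>UNIV. sigma2 X mu i b $ j * (v $ j)\<^sup>2)"
    by (simp add: inner_vec_def A_mat_mult_vec power2_eq_square mult_ac)
  also have "\<dots> > 0"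
    using j sigma2_pos by (intro sum_pos2[of _ j]) (auto simp: less_imp_le)
  finally show "0 < v \<bullet> (A_mat X mu i b *v v)" .
qed

text \<open>Uniqueness of the root identifies the abstract \<open>mat_sqrt\<close> with the
  entrywise one, after which computations become coordinatewise.\<close>

lemma sqrtA_eq: "sqrtA i b = (\<chi> j k. if j = k then sqrt (sigma2 X mu i b $ j) else 0)"
proof (rule mat_sqrt_eqI[OF A_mat_pos_def])
  let ?D = "\<chi> j k. if j = k then sqrt (sigma2 X mu i b $ j) else 0 :: real^'m^'m"
  show "pos_semidef_mat ?D"
    unfolding pos_semidef_mat_def
  proof (intro conjI allI)
    show "symmetric_mat ?D"
      by (rule symmetric_matI) (simp add: inner_vec_def diagonal_mult_vec mult_ac)
    show "0 \<le> v \<bullet> (?D *v v)" for v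
      unfolding inner_vec_def diagonal_mult_vec
      using sigma2_pos by (intro sum_nonneg) (simp add: less_imp_le mult.left_commute[of "_ $ _"])
  qed
  show "?D ** ?D = A_mat X mu i b"
    unfolding matrix_eq
    using sigma2_pos[of i b]
    by (simp add: vec_eq_iff matrix_vector_mul_assoc[symmetric] diagonal_mult_vec A_mat_mult_vec
        less_imp_le mult.assoc[symmetric])
qed

lemma isqrtA_eq: "isqrtA i b = (\<chi> j k. if j = k then 1 / sqrt (sigma2 X mu i b $ j) else 0)"
  unfolding mat_inv_sqrt_def
proof (rule matrix_inv_eqI)
  have "sqrt (sigma2 X mu i b $ j) \<noteq> 0" for j using sigma2_pos[of i b j] by simp
  then show "sqrtA i b ** (\<chi> j k. if j = k then 1 / sqrt (sigma2 X mu i b $ j) else 0) = mat 1"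
    unfolding matrix_eq
    by (simp add: vec_eq_iff matrix_vector_mul_assoc[symmetric] diagonal_mult_vec sqrtA_eq)
qed

lemma sqrtA_isqrtA [simp]: "sqrtA i b *v (isqrtA i b *v v) = v" "isqrtA i b *v (sqrtA i b *v v) = v"
proof -
  have "sqrt (sigma2 X mu i b $ j) \<noteq> 0" for j using sigma2_pos[of i b j] by simp
  then show "sqrtA i b *v (isqrtA i b *v v) = v" "isqrtA i b *v (sqrtA i b *v v) = v"
    by (simp_all add: vec_eq_iff diagonal_mult_vec sqrtA_eq isqrtA_eq)
qed

lemma sqrtA_sqrtA: "sqrtA i b *v (sqrtA i b *v v) = A_mat X mu i b *v v"
  by (simp add: matrix_vector_mul_assoc mat_sqrt_pos_def(2)[OF A_mat_pos_def])

lemma inner_sqrtA: "(sqrtA i b *v v) \<bullet> w = v \<bullet> (sqrtA i b *v w)"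
  and inner_isqrtA: "(isqrtA i b *v v) \<bullet> w = v \<bullet> (isqrtA i b *v w)"
  by (simp_all add: inner_vec_def sqrtA_eq isqrtA_eq diagonal_mult_vec mult_ac)

lemma cond_corr_entry:
  "cond_corr X mu Sc i b w $ j $ k =
     Sc i b w $ j $ k / (sqrt (sigma2 X mu i b $ j) * sqrt (sigma2 X mu i b $ k))"
  by (simp add: cond_corr_def isqrtA_eq matrix_matrix_mult_def if_distrib[of "\<lambda>x. x * _"]
      if_distrib[of "\<lambda>x. _ * x"] cong: if_cong)

lemma Sc_isqrtA: "Sc i b w *v (isqrtA i b *v v) = sqrtA i b *v (cond_corr X mu Sc i b w *v v)"
  by (simp add: cond_corr_def matrix_vector_mul_assoc[symmetric])

lemma cond_corr_measurable:
  "b \<in> T \<Longrightarrow> 1 \<le> i \<Longrightarrow> (\<lambda>w. cond_corr X mu Sc i b w $ j $ k) \<in> borel_measurable (past M y (i - 1))"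
  unfolding cond_corr_entry by (intro borel_measurable_divide Sc_measurable borel_measurable_const)

text \<open>Since \<open>Sc\<close> is only a version, symmetry and the unit diagonal hold almost
  surely; countably many indices allow one common null set. The lower bound is the eigenvalue
  hypothesis, the upper one comes from the unit diagonal.\<close>

lemma cond_corr_bounds:
  assumes b: "b \<in> T" and C: "0 < C"
    and low: "AE w in P b. \<forall>n\<ge>1. C \<le> lambda_min (cond_corr X mu Sc n b w)"
  shows "AE w in P b. \<forall>i\<ge>1. symmetric_mat (cond_corr X mu Sc i b w) \<and>
    (\<forall>v. C * (v \<bullet> v) \<le> v \<bullet> (cond_corr X mu Sc i b w *v v)) \<and>
    (\<forall>v. v \<bullet> (cond_corr X mu Sc i b w *v v) \<le> real CARD('m) * (v \<bullet> v))"
proof -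
  have "AE w in P b. \<forall>i j k. 1 \<le> i \<longrightarrow> Sc i b w $ j $ k = Sc i b w $ k $ j"
    unfolding AE_all_countable using Sc_symmetric[OF b] by (auto intro: AE_impI)
  moreover have "AE w in P b. \<forall>i j. 1 \<le> i \<longrightarrow> Sc i b w $ j $ j = sigma2 X mu i b $ j"
    unfolding AE_all_countable using Sc_diagonal[OF b] by (auto intro: AE_impI)
  ultimately show ?thesis using low
  proof eventually_elim
    case (elim w)
    show ?case
    proof (intro allI impI)
      fix i :: nat assume i: "1 \<le> i"
      let ?Q = "cond_corr X mu Sc i b w"
      have sym: "symmetric_mat ?Q"
        unfolding symmetric_mat_def using elim(1) i
        by (simp add: vec_eq_iff transpose_def cond_corr_entry mult.commute)
      have Q: "C * (v \<bullet> v) \<le> v \<bullet> (?Q *v v)" for v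
      proof -
        have "C * (v \<bullet> v) \<le> lambda_min ?Q * (v \<bullet> v)"
          using elim(3) i by (intro mult_right_mono) auto
        then show ?thesis using lambda_min_le_quadratic_form[OF sym, of v] by linarith
      qed
      have "?Q $ j $ j = 1" for j
        using elim(2) i sigma2_pos[of i b j] by (simp add: cond_corr_entry)
      then have "v \<bullet> (?Q *v v) \<le> real CARD('m) * (v \<bullet> v)" for v
        using pos_def_imp_semidef[OF coercive_pos_def[OF sym C Q]] by (intro correlation_upper_bound)
      with sym Q show "symmetric_mat ?Q \<and> (\<forall>v. C * (v \<bullet> v) \<le> v \<bullet> (?Q *v v)) \<and>
         (\<forall>v. v \<bullet> (?Q *v v) \<le> real CARD('m) * (v \<bullet> v))" by blast
    qed
  qed
qed

text \<open>A non-random vector whose squared length is the contribution of individual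
  \<open>i\<close> to the quadratic form of \<open>H_indep\<close> at \<open>l\<close>.\<close>

definition whitened :: "real^'p \<Rightarrow> nat \<Rightarrow> real^'p \<Rightarrow> real^'m" where
  "whitened b i l = sqrtA i b *v (X i *v l)"

text \<open>The coefficient of the residual of individual \<open>i\<close> in the \<open>l\<close>-component of the estimating
  function with working correlation \<open>R\<close>.\<close>

definition working :: "real^'p \<Rightarrow> (nat \<Rightarrow> 'w \<Rightarrow> real^'m^'m) \<Rightarrow> real^'p \<Rightarrow> nat \<Rightarrow> 'w \<Rightarrow> real^'m" where
  "working b R l i w = isqrtA i b *v (matrix_inv (R i w) *v whitened b i l)"

lemma sqrtA_whitened: "sqrtA i b *v whitened b i l = A_mat X mu i b *v (X i *v l)"
  by (simp add: whitened_def sqrtA_sqrtA)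

lemma H_indep_quadratic_form:
  "l \<bullet> (H_indep X mu n b *v l) = (\<Sum>i=1..n. whitened b i l \<bullet> whitened b i l)"
proof -
  have sum_mult: "sum F I *v v = (\<Sum>i\<in>I. F i *v v)" for F :: "nat \<Rightarrow> real^'p^'p" and I v
    by (induction I rule: infinite_finite_induct) (simp_all add: matrix_vector_mult_add_rdistrib)
  have "l \<bullet> ((transpose (X i) ** A_mat X mu i b ** X i) *v l) = whitened b i l \<bullet> whitened b i l" for i
  proof -
    have "l \<bullet> ((transpose (X i) ** A_mat X mu i b ** X i) *v l) =
        (X i *v l) \<bullet> (sqrtA i b *v whitened b i l)"
      unfolding sqrtA_whitened
      by (simp add: matrix_vector_mul_assoc[symmetric] transpose_matrix_vector)
        (metis dot_lmul_matrix inner_commute)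
    then show ?thesis by (simp add: inner_sqrtA[symmetric] whitened_def)
  qed
  then show ?thesis by (simp add: H_indep_def sum_mult inner_sum_right)
qed

lemma H_indep_symmetric: "symmetric_mat (H_indep X mu n b)"
proof -
  have "transpose (A_mat X mu i b) = A_mat X mu i b" for i
    using A_mat_pos_def[of i b] by (simp add: pos_def_mat_def symmetric_mat_def)
  then have "transpose (transpose (X i) ** A_mat X mu i b ** X i) = transpose (X i) ** A_mat X mu i b ** X i" for i
    by (simp add: matrix_transpose_mul transpose_transpose matrix_mul_assoc)
  moreover have "transpose (sum F I) = (\<Sum>i\<in>I. transpose (F i))" for F :: "nat \<Rightarrow> real^'p^'p" and I
    by (simp add: vec_eq_iff transpose_def)
  ultimately show ?thesis by (simp add: symmetric_mat_def H_indep_def)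
qed

text \<open>Symmetry of the inverse working matrix lets every factor be moved from the residual to
  the side of \<open>a\<close>.\<close>

lemma inner_gee_eq_score:
  assumes "\<And>i. i \<in> {1..n} \<Longrightarrow> pos_def_mat (R i b w)"
  shows "a \<bullet> gee y X mu R n b w = score b n (working b (\<lambda>i. R i b) a) w"
  unfolding gee_def score_def inner_sum_right
proof (intro sum.cong refl)
  fix i assume "i \<in> {1..n}"
  then have sym: "symmetric_mat (matrix_inv (R i b w))"
    using pos_def_matrix_inv[OF assms] by (simp add: pos_def_mat_def)
  show "a \<bullet> ((transpose (X i) ** sqrtA i b ** matrix_inv (R i b w) ** isqrtA i b) *v res i b w) =
      working b (\<lambda>i. R i b) a i w \<bullet> res i b w"
    unfolding working_def whitened_def inner_isqrtA symmetric_mat_inner[OF sym] inner_sqrtA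
    by (simp add: matrix_vector_mul_assoc[symmetric] transpose_matrix_vector)
      (metis dot_lmul_matrix inner_commute)
qed

text \<open>The coefficients are almost surely bounded: the inverse of a \<open>K\<close>-coercive
  matrix has norm at most \<open>1 / K\<close>, and the remaining factors are non-random.\<close>

lemma working_predictable:
  assumes b: "b \<in> T" and K: "0 < K"
    and meas: "\<And>i j k. 1 \<le> i \<Longrightarrow> (\<lambda>w. R i w $ j $ k) \<in> borel_measurable (past M y (i - 1))"
    and R: "AE w in P b. \<forall>i\<ge>1. symmetric_mat (R i w) \<and> (\<forall>v. K * (v \<bullet> v) \<le> v \<bullet> (R i w *v v))"
  shows "predictable_sq b n (working b R l)"
  unfolding predictable_sq_def
proof (intro ballI allI conjI)
  fix i j assume "i \<in> {1..n}"
  then have i: "1 \<le> i" by simp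
  show m: "(\<lambda>w. working b R l i w $ j) \<in> borel_measurable (past M y (i - 1))"
    unfolding working_def matrix_vector_mult_def[of "isqrtA i b"] matrix_vector_mult_def[of "matrix_inv _"]
    using borel_measurable_matrix_inv[OF meas[OF i]] by simp
  obtain G where G: "\<And>v. norm (isqrtA i b *v v) \<le> norm v * G" and "0 < G"
    using bounded_linear.pos_bounded[OF matrix_vector_mul_bounded_linear[of "isqrtA i b"]] by blast
  have "AE w in P b. \<bar>working b R l i w $ j\<bar> \<le> norm (whitened b i l) / K * G"
    using R
  proof eventually_elim
    case (elim w)
    have "norm (matrix_inv (R i w) *v whitened b i l) \<le> norm (whitened b i l) / K"
      using elim i K by (intro coercive_norm_matrix_inv_le) auto
    then have "norm (working b R l i w) \<le> norm (whitened b i l) / K * G"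
      unfolding working_def using G \<open>0 < G\<close> by (meson less_imp_le mult_right_mono order_trans)
    then show ?case using component_le_norm_cart order_trans by blast
  qed
  then show "sq_integrable (P b) (\<lambda>w. working b R l i w $ j)"
    using past_measurable_P[OF b m] prob_space.axioms(1)[OF prob_P[OF b]] by (intro sq_integrable_AE_bounded)
qed

end


section \<open>Efficiency of the working score\<close>

text \<open>Fixes one parameter \<open>b\<close>. \<open>R i\<close> is the matrix applied to
  individual \<open>i\<close>, so it must be known from the first \<open>i - 1\<close> individuals;
  the index shift of the sequence of working matrices is absorbed here.\<close>

locale working_correlation = longitudinal_model M P T y X mu Sc
  for M :: "'w measure" and P :: "real^'p \<Rightarrow> 'w measure" and T y and X :: "nat \<Rightarrow> real^'p^'m" and mu Sc +
  fixes b :: "real^'p" and R :: "nat \<Rightarrow> 'w \<Rightarrow> real^'m^'m" and C K :: real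
  assumes b: "b \<in> T" and C: "0 < C" and K: "0 < K"
    and Q_lower: "AE w in P b. \<forall>n\<ge>1. C \<le> lambda_min (cond_corr X mu Sc n b w)"
    and R_measurable: "\<And>i j k. 1 \<le> i \<Longrightarrow> (\<lambda>w. R i w $ j $ k) \<in> borel_measurable (past M y (i - 1))"
    and R_pos_def: "\<And>i w. w \<in> space M \<Longrightarrow> pos_def_mat (R i w)"
    and R_lower: "AE w in P b. \<forall>i\<ge>1. \<forall>v. K * (v \<bullet> v) \<le> v \<bullet> (R i w *v v)"
    and R_consistent: "\<And>j k. to_zero_in_prob (P b) (\<lambda>i w. R i w $ j $ k - cond_corr X mu Sc i b w $ j $ k)"
    and info_diverges: "filterlim (\<lambda>n. lambda_min (H_indep X mu n b)) at_top sequentially"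
begin

abbreviation "Q i \<equiv> cond_corr X mu Sc i b"

text \<open>The variance of the ideal score in direction \<open>l\<close>. It bounds every
  efficiency form from above and, asymptotically and up to a factor close to 1, that of the working
  score from below.\<close>

abbreviation "W n l \<equiv> \<integral>w. (score b n (working b Q l) w)\<^sup>2 \<partial>P b"

abbreviation "info n l \<equiv> \<Sum>i=1..n. whitened b i l \<bullet> whitened b i l"

sublocale prob_space "P b" using b by (rule prob_P)

section \<open>Comparison of the working score with the ideal score\<close>

lemma correlations_coercive: "AE w in P b. \<forall>i\<ge>1. symmetric_mat (Q i w) \<and>
    (\<forall>v. C * (v \<bullet> v) \<le> v \<bullet> (Q i w *v v)) \<and> (\<forall>v. v \<bullet> (Q i w *v v) \<le> real CARD('m) * (v \<bullet> v)) \<and>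
    symmetric_mat (R i w) \<and> (\<forall>v. K * (v \<bullet> v) \<le> v \<bullet> (R i w *v v))"
  using cond_corr_bounds[OF b C Q_lower] R_lower AE_space
  by eventually_elim (use R_pos_def space_P[OF b] in \<open>auto simp: pos_def_mat_def\<close>)

lemma working_Q_predictable: "predictable_sq b n (working b Q l)"
  using correlations_coercive by (intro working_predictable[OF b C] cond_corr_measurable b) (auto elim!: eventually_mono)

lemma working_R_predictable: "predictable_sq b n (working b R l)"
  using correlations_coercive by (intro working_predictable[OF b K] R_measurable) (auto elim!: eventually_mono)

lemma inner_isqrtA_Sc:
  "(isqrtA i b *v u) \<bullet> (Sc i b w *v (isqrtA i b *v v)) = u \<bullet> (Q i w *v v)"
  by (simp add: Sc_isqrtA inner_isqrtA)

text \<open>When \<open>Sc\<close> is applied to the ideal coefficient the correlation cancels. The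
  resulting expression is the expected Jacobian up to sign, so the ideal score represents that
  Jacobian as an inner product.\<close>

lemma integral_score_working_Q:
  assumes c: "predictable_sq b n c"
  shows "(\<integral>w. score b n c w * score b n (working b Q l) w \<partial>P b) =
    (\<Sum>i=1..n. \<integral>w. c i w \<bullet> (A_mat X mu i b *v (X i *v l)) \<partial>P b)"
  unfolding integral_score_mult[OF b c working_Q_predictable]
proof (intro sum.cong refl)
  fix i assume i: "i \<in> {1..n}"
  have [measurable]: "(\<lambda>w. c i w $ j) \<in> borel_measurable (P b)" for j
    using c i by (auto simp: predictable_sq_def sq_integrable_def)
  have "AE w in P b. c i w \<bullet> (Sc i b w *v working b Q l i w) = c i w \<bullet> (A_mat X mu i b *v (X i *v l))"
    using correlations_coercive
  proof eventually_elim
    case (elim w)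
    have "invertible (Q i w)"
      using elim i by (intro pos_def_invertible coercive_pos_def[OF _ C]) auto
    then show ?case
      by (simp add: working_def Sc_isqrtA matrix_inv_mult_vec sqrtA_whitened)
  qed
  moreover have "(\<lambda>w. c i w \<bullet> (A_mat X mu i b *v (X i *v l))) \<in> borel_measurable (P b)"
    unfolding inner_vec_def inner_real_def by measurable
  ultimately show "(\<integral>w. c i w \<bullet> (Sc i b w *v working b Q l i w) \<partial>P b) =
      (\<integral>w. c i w \<bullet> (A_mat X mu i b *v (X i *v l)) \<partial>P b)"
    using borel_measurable_integrable[OF integral_score_term(1)[OF b c working_Q_predictable i, of l]]
    by (intro integral_cong_AE)
qed

text \<open>The eigenvalues of the correlation matrix are at most \<open>CARD('m)\<close>, so those
  of its inverse are at least the reciprocal.\<close>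

lemma W_lower: "info n l / real CARD('m) \<le> W n l"
proof -
  have "info n l / real CARD('m) \<le>
      (\<Sum>i=1..n. \<integral>w. working b Q l i w \<bullet> (Sc i b w *v working b Q l i w) \<partial>P b)"
    unfolding sum_divide_distrib
  proof (intro sum_mono integral_ge_const)
    fix i assume i: "i \<in> {1..n}"
    show "integrable (P b) (\<lambda>w. working b Q l i w \<bullet> (Sc i b w *v working b Q l i w))"
      by (rule integral_score_term(1)[OF b working_Q_predictable working_Q_predictable i])
    show "AE w in P b. whitened b i l \<bullet> whitened b i l / real CARD('m) \<le>
        working b Q l i w \<bullet> (Sc i b w *v working b Q l i w)"
      using correlations_coercive
    proof eventually_elim
      case (elim w)
      have pd: "pos_def_mat (Q i w)" using elim i by (intro coercive_pos_def[OF _ C]) auto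
      have "whitened b i l \<bullet> whitened b i l / real CARD('m) \<le>
          whitened b i l \<bullet> (matrix_inv (Q i w) *v whitened b i l)"
        using elim i by (intro matrix_inv_lower_bound pd) auto
      then show ?case
        by (simp add: working_def inner_isqrtA_Sc matrix_inv_mult_vec pos_def_invertible[OF pd] inner_commute)
    qed
  qed
  then show ?thesis
    by (simp add: power2_eq_square integral_score_mult[OF b working_Q_predictable working_Q_predictable])
qed

text \<open>The smaller of the two bounds of \<open>inverse_discrepancy\<close>: the first tends to zero in
  probability and the constant one makes bounded convergence applicable.\<close>

definition discrepancy :: "nat \<Rightarrow> real" where
  "discrepancy i = (\<integral>w. min (1 / (C * K\<^sup>2) * (\<Sum>j\<in>UNIV. \<Sum>k\<in>UNIV. \<bar>R i w $ j $ k - Q i w $ j $ k\<bar>)\<^sup>2)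
     (2 / C + 2 * real CARD('m) / K\<^sup>2) \<partial>P b)"

lemma entry_diff_measurable:
  "1 \<le> i \<Longrightarrow> (\<lambda>w. R i w $ j $ k - Q i w $ j $ k) \<in> borel_measurable (P b)"
  using past_measurable_P[OF b R_measurable] past_measurable_P[OF b cond_corr_measurable[OF b]]
  by (intro borel_measurable_diff)

lemma discrepancy_tendsto_0: "discrepancy \<longlonglongrightarrow> 0"
  unfolding discrepancy_def[abs_def]
  using C K by (intro integral_truncated_square_tendsto_0 entry_diff_measurable R_consistent) auto

lemma discrepancy_integrable:
  assumes "1 \<le> i"
  shows "integrable (P b) (\<lambda>w. min (1 / (C * K\<^sup>2) * (\<Sum>j\<in>UNIV. \<Sum>k\<in>UNIV. \<bar>R i w $ j $ k - Q i w $ j $ k\<bar>)\<^sup>2)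
     (2 / C + 2 * real CARD('m) / K\<^sup>2))"
proof -
  note [measurable] = entry_diff_measurable[OF assms]
  have "\<bar>min x B\<bar> \<le> B" if "0 \<le> x" "0 \<le> B" for x B :: real using that by (auto simp: min_def)
  then show ?thesis
    using C K by (intro integrable_const_bound[where B = "2 / C + 2 * real CARD('m) / K\<^sup>2"] AE_I2) auto
qed

text \<open>The difference is again a predictable transform, so its second moment is a sum of
  conditional forms, each controlled by \<open>inverse_discrepancy\<close>; the whitened vectors are
  non-random and leave the integral.\<close>

lemma integral_score_diff_le:
  "(\<integral>w. (score b n (working b Q l) w - score b n (working b R l) w)\<^sup>2 \<partial>P b) \<le>
     (\<Sum>i=1..n. (whitened b i l \<bullet> whitened b i l) * discrepancy i)"
proof -
  define c where "c i w = working b Q l i w - working b R l i w" for i w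
  have c: "predictable_sq b n c"
    unfolding predictable_sq_def
  proof (intro ballI allI conjI)
    fix i j assume i: "i \<in> {1..n}"
    have m: "(\<lambda>w. working b Q l i w $ j) \<in> borel_measurable (past M y (i - 1))"
      "(\<lambda>w. working b R l i w $ j) \<in> borel_measurable (past M y (i - 1))"
      and sq: "sq_integrable (P b) (\<lambda>w. working b Q l i w $ j)"
      "sq_integrable (P b) (\<lambda>w. working b R l i w $ j)"
      using working_Q_predictable[of n l] working_R_predictable[of n l] i by (auto simp: predictable_sq_def)
    show "(\<lambda>w. c i w $ j) \<in> borel_measurable (past M y (i - 1))"
      using m by (simp add: c_def)
    show "sq_integrable (P b) (\<lambda>w. c i w $ j)"
      using sq_integrable_add[OF sq(1) sq_integrable_scale[OF sq(2), of "-1"]] by (simp add: c_def)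
  qed
  have "score b n (working b Q l) w - score b n (working b R l) w = score b n c w" for w
    by (simp add: score_def c_def inner_diff_left sum_subtractf)
  then have "(\<integral>w. (score b n (working b Q l) w - score b n (working b R l) w)\<^sup>2 \<partial>P b) =
      (\<Sum>i=1..n. \<integral>w. c i w \<bullet> (Sc i b w *v c i w) \<partial>P b)"
    by (simp add: power2_eq_square integral_score_mult[OF b c c])
  also have "\<dots> \<le> (\<Sum>i=1..n. (whitened b i l \<bullet> whitened b i l) * discrepancy i)"
  proof (intro sum_mono)
    fix i assume i: "i \<in> {1..n}"
    then have i1: "1 \<le> i" by simp
    let ?Z = "\<lambda>w. min (1 / (C * K\<^sup>2) * (\<Sum>j\<in>UNIV. \<Sum>k\<in>UNIV. \<bar>R i w $ j $ k - Q i w $ j $ k\<bar>)\<^sup>2)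
     (2 / C + 2 * real CARD('m) / K\<^sup>2)"
    have "(\<integral>w. c i w \<bullet> (Sc i b w *v c i w) \<partial>P b) \<le>
        (\<integral>w. (whitened b i l \<bullet> whitened b i l) * ?Z w \<partial>P b)"
    proof (rule integral_mono_AE)
      show "integrable (P b) (\<lambda>w. c i w \<bullet> (Sc i b w *v c i w))"
        by (rule integral_score_term(1)[OF b c c i])
      show "integrable (P b) (\<lambda>w. (whitened b i l \<bullet> whitened b i l) * ?Z w)"
        using discrepancy_integrable[OF i1] by (rule integrable_mult_right)
      show "AE w in P b. c i w \<bullet> (Sc i b w *v c i w) \<le> (whitened b i l \<bullet> whitened b i l) * ?Z w"
        using correlations_coercive
      proof eventually_elim
        case (elim w)
        define u where "u = matrix_inv (Q i w) *v whitened b i l - matrix_inv (R i w) *v whitened b i l"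
        have cu: "c i w = isqrtA i b *v u"
          by (simp add: c_def working_def u_def matrix_vector_mult_diff_distrib)
        have g: "symmetric_mat (Q i w)" "\<And>v. C * (v \<bullet> v) \<le> v \<bullet> (Q i w *v v)"
          "\<And>v. v \<bullet> (Q i w *v v) \<le> real CARD('m) * (v \<bullet> v)"
          "symmetric_mat (R i w)" "\<And>v. K * (v \<bullet> v) \<le> v \<bullet> (R i w *v v)"
          using elim i1 by blast+
        have "u \<bullet> (Q i w *v u) \<le> ?Z w * (whitened b i l \<bullet> whitened b i l)"
          using inverse_discrepancy[OF g(1) C g(2,3,4) K g(5), of "whitened b i l"]
          by (simp add: u_def min_def)
        then show ?case by (simp add: cu inner_isqrtA_Sc mult.commute)
      qed
    qed
    then show "(\<integral>w. c i w \<bullet> (Sc i b w *v c i w) \<partial>P b) \<le> (whitened b i l \<bullet> whitened b i l) * discrepancy i"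
      by (simp add: discrepancy_def)
  qed
  finally show ?thesis .
qed

lemma info_lower: "lambda_min (H_indep X mu n b) * (l \<bullet> l) \<le> info n l"
  using lambda_min_le_quadratic_form[OF H_indep_symmetric, of n b l] by (simp add: H_indep_quadratic_form)

lemma score_diff_negligible:
  assumes e: "0 < e"
  shows "\<forall>\<^sub>F n in sequentially. \<forall>l.
    (\<integral>w. (score b n (working b Q l) w - score b n (working b R l) w)\<^sup>2 \<partial>P b) \<le> e * W n l"
proof -
  define m where "m = real CARD('m)"
  have m: "0 < m" by (simp add: m_def)
  have up: "\<exists>G. \<forall>l. info n l \<le> G * (l \<bullet> l)" for n
  proof -
    obtain G where G: "\<And>l. norm (H_indep X mu n b *v l) \<le> norm l * G"
      using bounded_linear.pos_bounded[OF matrix_vector_mul_bounded_linear[of "H_indep X mu n b"]] by blast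
    have "info n l \<le> G * (l \<bullet> l)" for l
    proof -
      have "info n l \<le> norm l * norm (H_indep X mu n b *v l)"
        unfolding H_indep_quadratic_form[symmetric] by (rule norm_cauchy_schwarz)
      also have "\<dots> \<le> norm l * (norm l * G)" using G by (intro mult_left_mono) auto
      finally show ?thesis by (simp add: dot_square_norm power2_eq_square mult_ac)
    qed
    then show ?thesis by blast
  qed
  \<comment> \<open>Index 0 enters the maximum by hand, because integrability of the integrand is
    available from index 1 on.\<close>
  have bd: "discrepancy i \<le> max (discrepancy 0) (2 / C + 2 * real CARD('m) / K\<^sup>2)" for i
  proof (cases "i = 0")
    case False
    then have "discrepancy i \<le> (\<integral>w. 2 / C + 2 * real CARD('m) / K\<^sup>2 \<partial>P b)"
      unfolding discrepancy_def by (intro integral_mono discrepancy_integrable) auto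
    then show ?thesis by (simp add: prob_space)
  qed simp
  \<comment> \<open>The tolerance is divided by \<open>m\<close> to compensate for the factor lost
    in \<open>W_lower\<close>.\<close>
  have "\<forall>\<^sub>F n in sequentially. \<forall>l. (\<Sum>i=1..n. (whitened b i l \<bullet> whitened b i l) * discrepancy i) \<le> (e / m) * info n l"
    using e m up info_lower info_diverges bd discrepancy_tendsto_0
    by (intro weighted_information_negligible[where H = "\<lambda>i l. whitened b i l \<bullet> whitened b i l"]) auto
  then show ?thesis
  proof eventually_elim
    case (elim n)
    show ?case
    proof
      fix l
      have "(\<integral>w. (score b n (working b Q l) w - score b n (working b R l) w)\<^sup>2 \<partial>P b) \<le> (e / m) * info n l"
        using integral_score_diff_le[where n = n and l = l] elim by (meson order_trans)
      also have "\<dots> = e * (info n l / m)" by simp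
      also have "\<dots> \<le> e * W n l"
        using W_lower[where n = n and l = l] e unfolding m_def by (intro mult_left_mono) auto
      finally show "(\<integral>w. (score b n (working b Q l) w - score b n (working b R l) w)\<^sup>2 \<partial>P b) \<le> e * W n l" .
    qed
  qed
qed

section \<open>Efficiency as an orthogonal projection\<close>

lemma H_class_forms:
  assumes qH: "q \<in> H_class M P T y X mu Sc n"
  shows "sq_integrable (P b) (\<lambda>w. a \<bullet> q b w)"
    and "a \<bullet> (cov_mat (P b) (q b) *v a') = (\<integral>w. (a \<bullet> q b w) * (a' \<bullet> q b w) \<partial>P b)"
    and "a \<bullet> (exp_jacobian P q b *v l) = - (\<integral>w. (a \<bullet> q b w) * score b n (working b Q l) w \<partial>P b)"
proof -
  obtain c where c: "\<And>a. predictable_sq b n (c a)"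
    "\<And>a w. w \<in> space M \<Longrightarrow> a \<bullet> q b w = score b n (c a) w"
    "\<And>a l. a \<bullet> (exp_jacobian P q b *v l) =
       - (\<Sum>i=1..n. \<integral>w. c a i w \<bullet> (A_mat X mu i b *v (X i *v l)) \<partial>P b)"
    using H_class_representation[OF qH b] by blast
  have sp: "w \<in> space (P b) \<longleftrightarrow> w \<in> space M" for w using space_P[OF b] by simp
  show sq: "sq_integrable (P b) (\<lambda>w. a \<bullet> q b w)" for a
    using score_sq_integrable[OF b c(1), of a] by (subst sq_integrable_cong) (auto simp: sp c(2))
  have mean: "(\<integral>w. a \<bullet> q b w \<partial>P b) = 0" for a
    using score_mean[OF b c(1), of a] by (subst Bochner_Integration.integral_cong[OF refl]) (auto simp: sp c(2))
  show "a \<bullet> (cov_mat (P b) (q b) *v a') = (\<integral>w. (a \<bullet> q b w) * (a' \<bullet> q b w) \<partial>P b)"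
    using sq[of "axis _ 1"] mean[of "axis _ 1"] by (intro cov_mat_quadratic_form) (simp_all add: inner_axis')
  have "(\<integral>w. (a \<bullet> q b w) * score b n (working b Q l) w \<partial>P b) =
      (\<integral>w. score b n (c a) w * score b n (working b Q l) w \<partial>P b)"
    by (intro Bochner_Integration.integral_cong) (auto simp: sp c(2))
  then show "a \<bullet> (exp_jacobian P q b *v l) = - (\<integral>w. (a \<bullet> q b w) * score b n (working b Q l) w \<partial>P b)"
    by (simp add: c(3) integral_score_working_Q[OF c(1)])
qed

lemma cov_mat_pos_semidef:
  assumes "q \<in> H_class M P T y X mu Sc n"
  shows "pos_semidef_mat (cov_mat (P b) (q b))"
  unfolding pos_semidef_mat_def
proof (intro conjI allI)
  note F = H_class_forms[OF assms]
  show "symmetric_mat (cov_mat (P b) (q b))"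
    by (rule symmetric_matI) (simp add: F(2) inner_commute[of "cov_mat (P b) (q b) *v _"] mult.commute)
  show "0 \<le> v \<bullet> (cov_mat (P b) (q b) *v v)" for v
    by (simp add: F(2))
qed

text \<open>Expansion of the square. The sign on the left is plus because the expected Jacobian is
  minus the inner product with the ideal score; minimising over \<open>a\<close> projects that score
  onto the span of the components of \<open>q\<close>.\<close>

lemma projection_error:
  assumes qH: "q \<in> H_class M P T y X mu Sc n"
  shows "(\<integral>w. (a \<bullet> q b w + score b n (working b Q l) w)\<^sup>2 \<partial>P b) =
    a \<bullet> (cov_mat (P b) (q b) *v a) - 2 * (a \<bullet> (exp_jacobian P q b *v l)) + W n l"
proof -
  note F = H_class_forms[OF qH]
  have sq: "sq_integrable (P b) (score b n (working b Q l))"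
    by (rule score_sq_integrable[OF b working_Q_predictable])
  have "(\<integral>w. (a \<bullet> q b w + score b n (working b Q l) w)\<^sup>2 \<partial>P b) =
      (\<integral>w. (a \<bullet> q b w) * (a \<bullet> q b w) + 2 * ((a \<bullet> q b w) * score b n (working b Q l) w)
         + (score b n (working b Q l) w)\<^sup>2 \<partial>P b)"
    by (intro Bochner_Integration.integral_cong) (auto simp: power2_eq_square algebra_simps)
  also have "\<dots> = (\<integral>w. (a \<bullet> q b w) * (a \<bullet> q b w) \<partial>P b)
      + 2 * (\<integral>w. (a \<bullet> q b w) * score b n (working b Q l) w \<partial>P b) + W n l"
    using sq_integrable_mult[OF F(1)[of a] F(1)[of a]] sq_integrable_mult[OF F(1)[of a] sq] sq
    by (simp add: sq_integrable_def)
  finally show ?thesis by (simp add: F(2,3))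
qed

text \<open>A projection is never longer than the projected vector. Definiteness follows from
  semidefiniteness, obtained with the trial vector 0, and invertibility.\<close>

lemma eff_mat_le:
  assumes qH: "q \<in> H_class M P T y X mu Sc n" and def: "info_defined P q b"
  shows "l \<bullet> (eff_mat P q b *v l) \<le> W n l" and "pos_def_mat (eff_mat P q b)"
proof -
  let ?V = "cov_mat (P b) (q b)"
  have V: "pos_semidef_mat ?V" "symmetric_mat ?V" "invertible ?V"
    using cov_mat_pos_semidef[OF qH] def by (auto simp: pos_semidef_mat_def info_defined_def)
  have "0 \<le> a \<bullet> (?V *v a) - 2 * (a \<bullet> (exp_jacobian P q b *v l)) + W n l" for a
    unfolding projection_error[OF qH, symmetric] by simp
  then show "l \<bullet> (eff_mat P q b *v l) \<le> W n l"
    unfolding eff_mat_def by (rule eff_quadratic_form_le[OF V(2,3)])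
  have "0 \<le> v \<bullet> (eff_mat P q b *v v)" for v
    using eff_quadratic_form_ge[OF V(1,3), of 0 "exp_jacobian P q b" v] by (simp add: eff_mat_def)
  then have "pos_semidef_mat (eff_mat P q b)"
    using symmetric_eff[OF V(2,3)] by (simp add: pos_semidef_mat_def eff_mat_def)
  then show "pos_def_mat (eff_mat P q b)"
    using def by (intro invertible_pos_semidef_imp_pos_def) (auto simp: info_defined_def)
qed

text \<open>Needed for nonsingularity of the covariance of the working score. A zero integral would,
  by coercivity of \<open>Q\<close>, force \<open>matrix_inv (R i w) *v whitened b i l\<close> to
  vanish almost surely, and invertibility of \<open>R i w\<close> would then force the nonzero
  whitened vector to vanish.\<close>

lemma score_working_R_pos:
  assumes "0 < info n l"
  shows "0 < (\<integral>w. score b n (working b R l) w * score b n (working b R l) w \<partial>P b)"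
proof -
  note wR = working_R_predictable[of n l]
  let ?f = "\<lambda>i w. working b R l i w \<bullet> (Sc i b w *v working b R l i w)"
  have bound: "AE w in P b. C * (norm (matrix_inv (R i w) *v whitened b i l))\<^sup>2 \<le> ?f i w" if "i \<in> {1..n}" for i
    using correlations_coercive that
    by (auto elim!: eventually_mono simp: working_def inner_isqrtA_Sc dot_square_norm[symmetric])
  have nonneg: "AE w in P b. 0 \<le> ?f i w" if "i \<in> {1..n}" for i
    using bound[OF that] C by (auto elim!: eventually_mono intro: order_trans[rotated])
  have int: "integrable (P b) (?f i)" if "i \<in> {1..n}" for i
    by (rule integral_score_term(1)[OF b wR wR that])
  have "\<exists>i\<in>{1..n}. whitened b i l \<noteq> 0"
  proof (rule ccontr)
    assume "\<not> ?thesis"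
    then have "info n l = 0" by simp
    with assms show False by simp
  qed
  then obtain i where i: "i \<in> {1..n}" "whitened b i l \<noteq> 0" by blast
  have "(\<integral>w. ?f i w \<partial>P b) \<noteq> 0"
  proof
    assume "(\<integral>w. ?f i w \<partial>P b) = 0"
    then have "AE w in P b. ?f i w = 0"
      using integral_nonneg_eq_0_iff_AE[OF int nonneg] i(1) by simp
    then have "AE w in P b. False"
      using bound[OF i(1)] AE_space
    proof eventually_elim
      case (elim w)
      have "matrix_inv (R i w) *v whitened b i l = 0" using elim(1,2) C by (simp add: mult_le_0_iff)
      moreover have "invertible (R i w)"
        using R_pos_def elim(3) space_P[OF b] by (intro pos_def_invertible) auto
      ultimately show False
        using i(2) matrix_inv_mult_vec(1)[of "R i w" "whitened b i l"] by simp
    qed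
    then show False by simp
  qed
  moreover have "0 \<le> (\<integral>w. ?f i w \<partial>P b)" if "i \<in> {1..n}" for i
    using nonneg[OF that] by (rule integral_nonneg_AE)
  ultimately have "0 < (\<Sum>i=1..n. \<integral>w. ?f i w \<partial>P b)"
    using i(1) by (intro sum_pos2[of _ i]) (auto simp: order_less_le)
  then show ?thesis by (simp add: integral_score_mult[OF b wR wR])
qed

text \<open>One \<open>n\<close> must serve all \<open>l\<close> at once, since comparing inverse
  matrices requires the inequality in every direction.\<close>

lemma eff_mat_working_ge:
  fixes q :: "nat \<Rightarrow> real^'p \<Rightarrow> 'w \<Rightarrow> real^'p"
  assumes qH: "\<And>n. 1 \<le> n \<Longrightarrow> q n \<in> H_class M P T y X mu Sc n"
    and q: "\<And>n w a. w \<in> space M \<Longrightarrow> a \<bullet> q n b w = score b n (working b R a) w"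
    and e: "0 < e" "e < 1"
  shows "\<forall>\<^sub>F n in sequentially. info_defined P (q n) b \<and> pos_def_mat (eff_mat P (q n) b) \<and>
    (\<forall>l. (1 - e) * W n l \<le> l \<bullet> (eff_mat P (q n) b *v l))"
proof -
  have "\<forall>\<^sub>F n in sequentially. 0 < lambda_min (H_indep X mu n b)"
    using info_diverges by (auto simp: filterlim_at_top_dense)
  then show ?thesis using score_diff_negligible[OF e(1)] eventually_ge_at_top[of 1]
  proof eventually_elim
    case (elim n)
    let ?V = "cov_mat (P b) (q n b)" and ?E = "eff_mat P (q n) b"
    note H = qH[OF elim(3)]
    have sp: "w \<in> space (P b) \<longleftrightarrow> w \<in> space M" for w using space_P[OF b] by simp
    have info: "0 < info n l" if "l \<noteq> 0" for l
    proof -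
      have "0 < lambda_min (H_indep X mu n b) * (l \<bullet> l)" using elim(1) that by simp
      then show ?thesis using info_lower[of n l] by linarith
    qed
    have "l \<bullet> (?V *v l) = (\<integral>w. score b n (working b R l) w * score b n (working b R l) w \<partial>P b)" for l
      unfolding H_class_forms(2)[OF H]
      by (intro Bochner_Integration.integral_cong) (auto simp: sp q)
    then have inv: "invertible ?V"
      using score_working_R_pos[OF info] by (intro invertibleI_quadratic_form) (simp add: less_imp_neq[symmetric])
    have V: "pos_semidef_mat ?V" by (rule cov_mat_pos_semidef[OF H])
    have ge: "(1 - e) * W n l \<le> l \<bullet> (?E *v l)" for l
    proof -
      \<comment> \<open>The trial vector \<open>- l\<close> turns the projection error into the
        squared distance between ideal and working score, already known to be negligible.\<close>
      have "(\<integral>w. (score b n (working b Q l) w - score b n (working b R l) w)\<^sup>2 \<partial>P b) =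
          (\<integral>w. ((- l) \<bullet> q n b w + score b n (working b Q l) w)\<^sup>2 \<partial>P b)"
        by (intro Bochner_Integration.integral_cong) (auto simp: sp q)
      also have "\<dots> = (- l) \<bullet> (?V *v (- l)) - 2 * ((- l) \<bullet> (exp_jacobian P (q n) b *v l)) + W n l"
        by (rule projection_error[OF H])
      finally have "(- l) \<bullet> (?V *v (- l)) - 2 * ((- l) \<bullet> (exp_jacobian P (q n) b *v l)) + W n l \<le> e * W n l"
        using elim(2)[rule_format, of l] by (simp only:)
      then show ?thesis
        using eff_quadratic_form_ge[OF V inv, of "- l" "exp_jacobian P (q n) b" l]
        by (simp add: eff_mat_def algebra_simps)
    qed
    have "pos_def_mat ?E"
      unfolding pos_def_mat_def
    proof (intro conjI allI impI)
      show "symmetric_mat ?E"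
        unfolding eff_mat_def using V inv by (intro symmetric_eff) (auto simp: pos_semidef_mat_def)
      fix v :: "real^'p" assume "v \<noteq> 0"
      then have "0 < info n v / real CARD('m)" using info by simp
      then have "0 < W n v" using W_lower[where n = n and l = v] by linarith
      then have "0 < (1 - e) * W n v" using e by simp
      then show "0 < v \<bullet> (?E *v v)" using ge[of v] by linarith
    qed
    then show ?case using inv ge pos_def_invertible by (auto simp: info_defined_def)
  qed
qed

lemma working_Liminf:
  fixes q q' :: "nat \<Rightarrow> real^'p \<Rightarrow> 'w \<Rightarrow> real^'p"
  assumes qH: "\<And>n. 1 \<le> n \<Longrightarrow> q n \<in> H_class M P T y X mu Sc n"
    and q: "\<And>n w a. w \<in> space M \<Longrightarrow> a \<bullet> q n b w = score b n (working b R a) w"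
    and q'H: "\<And>n. 1 \<le> n \<Longrightarrow> q' n \<in> H_class M P T y X mu Sc n"
    and def: "\<forall>\<^sub>F n in sequentially. info_defined P (q' n) b" and l: "norm l = 1"
  shows "0 \<le> Liminf sequentially (\<lambda>n. ereal (l \<bullet>
    ((mat_inv_sqrt (info_mat P (q n) b) ** info_mat P (q' n) b ** mat_inv_sqrt (info_mat P (q n) b) - mat 1) *v l)))"
  unfolding le_Liminf_iff
proof (intro allI impI)
  fix z :: ereal assume "z < 0"
  then obtain d where d: "z < ereal d" "ereal d < 0" using ereal_dense2 by blast
  \<comment> \<open>The cap \<open>1 / 2\<close> keeps \<open>1 - e\<close> positive, and
    \<open>e \<le> - d\<close> makes the final bound \<open>- e\<close> at least
    \<open>d\<close>.\<close>
  define e where "e = min (- d) (1 / 2)"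
  have e: "0 < e" "e < 1" "e \<le> - d" using d(2) by (auto simp: e_def)
  show "\<forall>\<^sub>F n in sequentially. z < ereal (l \<bullet>
    ((mat_inv_sqrt (info_mat P (q n) b) ** info_mat P (q' n) b ** mat_inv_sqrt (info_mat P (q n) b) - mat 1) *v l))"
    using eff_mat_working_ge[OF qH q e(1,2), simplified] def eventually_ge_at_top[of 1]
  proof eventually_elim
    case (elim n)
    note le = eff_mat_le[OF q'H[OF elim(3)] elim(2)]
    \<comment> \<open>The ratio bound is used with \<open>k = 1 / (1 - e)\<close>:
      \<open>W n v\<close> lies between the form of the competitor and \<open>k\<close> times that
      of the working score.\<close>
    have "1 / (1 / (1 - e)) - 1 \<le> l \<bullet> ((mat_inv_sqrt (info_mat P (q n) b) ** info_mat P (q' n) b **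
        mat_inv_sqrt (info_mat P (q n) b) - mat 1) *v l)"
      unfolding info_mat_def
    proof (rule info_ratio_ge[OF le(2) _ _ _ l])
      show "v \<bullet> (eff_mat P (q' n) b *v v) \<le> 1 / (1 - e) * (v \<bullet> (eff_mat P (q n) b *v v))" for v
      proof -
        have "W n v \<le> 1 / (1 - e) * (v \<bullet> (eff_mat P (q n) b *v v))"
          using elim(1) e by (simp add: field_simps)
        then show ?thesis using le(1)[of v] by linarith
      qed
    qed (use elim(1) e in auto)
    then have "d \<le> l \<bullet> ((mat_inv_sqrt (info_mat P (q n) b) ** info_mat P (q' n) b **
        mat_inv_sqrt (info_mat P (q n) b) - mat 1) *v l)"
      using e(3) by simp
    then show ?case using d(1) by (meson ereal_less_eq(3) less_le_trans)
  qed
qed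

end

text \<open>The range of generating indices is empty at 0, so the sigma-algebra is trivial and a
  nonempty level set is the whole space.\<close>

lemma (in longitudinal_model) measurable_past_0_constant:
  assumes f: "f \<in> borel_measurable (past M y 0)" and w: "w \<in> space M" "w' \<in> space M"
  shows "f w = (f w' :: real)"
proof -
  have "f -` {f w'} \<inter> space (past M y 0) \<in> sets (past M y 0)"
    using f by (rule measurable_sets) simp
  then have "f -` {f w'} \<inter> space M \<in> {{}, space M}"
    by (simp add: sets_past sigma_sets_empty_eq)
  then show ?thesis using w by blast
qed

theorem theorem3p9:
  fixes M :: "'w measure"
    and P :: "real^'p \<Rightarrow> 'w measure"
    and T :: "(real^'p) set"
    and y :: "nat \<Rightarrow> 'w \<Rightarrow> real^'m"
    and X :: "nat \<Rightarrow> real^'p^'m"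
    and mu :: "real \<Rightarrow> real"
    and Sc :: "nat \<Rightarrow> real^'p \<Rightarrow> 'w \<Rightarrow> real^'m^'m"
    and Rs :: "nat \<Rightarrow> real^'p \<Rightarrow> 'w \<Rightarrow> real^'m^'m"
  assumes model: "longitudinal_model M P T y X mu Sc"
    and cond1: "\<forall>b\<in>T. \<exists>C>0. AE w in P b. \<forall>n\<ge>1. C \<le> lambda_min (cond_corr X mu Sc n b w)"
    and cond2: "\<forall>b\<in>T. filterlim (\<lambda>n. lambda_min (H_indep X mu n b)) at_top sequentially"
    and Rs_pos_def: "\<forall>n. \<forall>b\<in>T. \<forall>w\<in>space M. pos_def_mat (Rs n b w)"
    and Rs_smooth: "\<forall>n. \<forall>w\<in>space M. cont_differentiable_on (\<lambda>b. Rs n b w) T"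
    and Rs_measurable: "\<forall>n. \<forall>b\<in>T. \<forall>j k. (\<lambda>w. Rs n b w $ j $ k) \<in> borel_measurable (past M y n)"
    and cond3: "\<forall>b\<in>T. \<forall>j k. to_zero_in_prob (P b)
                  (\<lambda>n. \<lambda>w. Rs (n - 1) b w $ j $ k - cond_corr X mu Sc n b w $ j $ k)"
    and cond4: "\<forall>b\<in>T. \<exists>K>0. AE w in P b. \<forall>n\<ge>1. K \<le> lambda_min (Rs n b w)"
    and g_star_in_H: "\<forall>n\<ge>1. gee y X mu (\<lambda>i. Rs (i - 1)) n \<in> H_class M P T y X mu Sc n"
    and g_bar_in_H: "\<forall>n\<ge>1. gee y X mu (cond_corr X mu Sc) n \<in> H_class M P T y X mu Sc n"
  shows "asymptotically_optimal M P T y X mu Sc (gee y X mu (\<lambda>i. Rs (i - 1)))"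
proof -
  interpret longitudinal_model M P T y X mu Sc by fact
  let ?g = "gee y X mu (\<lambda>i. Rs (i - 1))"
  \<comment> \<open>The constants depend on the parameter, so the locale is instantiated separately
    at each \<open>b\<close>.\<close>
  have *: "\<exists>C K. working_correlation M P T y X mu Sc b (\<lambda>i. Rs (i - 1) b) C K" if b: "b \<in> T" for b
  proof -
    interpret prob_space "P b" using b by (rule prob_P)
    obtain C where C: "0 < C" "AE w in P b. \<forall>n\<ge>1. C \<le> lambda_min (cond_corr X mu Sc n b w)"
      using cond1 b by blast
    obtain K1 where K1: "0 < K1" "AE w in P b. \<forall>n\<ge>1. K1 \<le> lambda_min (Rs n b w)"
      using cond4 b by blast
    obtain w0 where w0: "w0 \<in> space M" using not_empty space_P[OF b] by auto
    \<comment> \<open>Condition (4) says nothing about \<open>Rs 0\<close>, but this matrix is non-random.\<close>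
    have const: "Rs 0 b w = Rs 0 b w0" if "w \<in> space M" for w
      unfolding vec_eq_iff using Rs_measurable b
      by (intro allI measurable_past_0_constant[of "\<lambda>w. Rs 0 b w $ _ $ _", OF _ that w0]) blast
    obtain K0 where K0: "0 < K0" "\<And>v. K0 * (v \<bullet> v) \<le> v \<bullet> (Rs 0 b w0 *v v)"
      using pos_def_lower_bound Rs_pos_def b w0 by metis
    \<comment> \<open>One constant covers the non-random \<open>Rs 0\<close> and the almost sure
      bound that starts at index 1.\<close>
    define K where "K = min K0 K1"
    have lower: "AE w in P b. \<forall>i\<ge>1. \<forall>v. K * (v \<bullet> v) \<le> v \<bullet> (Rs (i - 1) b w *v v)"
      using K1(2) AE_space
    proof eventually_elim
      case (elim w)
      then have w: "w \<in> space M" using space_P[OF b] by simp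
      show ?case
      proof (intro allI impI)
        fix i :: nat and v :: "real^'m" assume "1 \<le> i"
        show "K * (v \<bullet> v) \<le> v \<bullet> (Rs (i - 1) b w *v v)"
        proof (cases "i - 1 = 0")
          case True
          have "K * (v \<bullet> v) \<le> K0 * (v \<bullet> v)" by (intro mult_right_mono) (auto simp: K_def)
          then show ?thesis using K0(2)[of v] True const[OF w] by simp
        next
          case False
          have "symmetric_mat (Rs (i - 1) b w)" using Rs_pos_def b w by (simp add: pos_def_mat_def)
          note lambda_min_le_quadratic_form[OF this, of v]
          moreover have "K * (v \<bullet> v) \<le> lambda_min (Rs (i - 1) b w) * (v \<bullet> v)"
            using elim(1) False by (intro mult_right_mono) (auto simp: K_def min_le_iff_disj)
          ultimately show ?thesis by linarith
        qed
      qed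
    qed
    have "working_correlation M P T y X mu Sc b (\<lambda>i. Rs (i - 1) b) C K"
      by unfold_locales (use b C K0(1) K1(1) lower Rs_measurable Rs_pos_def cond2 cond3 in \<open>auto simp: K_def\<close>)
    then show ?thesis by blast
  qed
  have H: "?g n \<in> H_class M P T y X mu Sc n" if "1 \<le> n" for n using g_star_in_H that by blast
  have g: "a \<bullet> ?g n b w = score b n (working b (\<lambda>i. Rs (i - 1) b) a) w"
    if "b \<in> T" "w \<in> space M" for a n b w
    using Rs_pos_def that by (intro inner_gee_eq_score) auto
  show ?thesis
    unfolding asymptotically_optimal_def
  proof (intro conjI allI impI ballI)
    show "?g n \<in> H_class M P T y X mu Sc n" if "1 \<le> n" for n using that by (rule H)
  next
    fix b assume b: "b \<in> T"
    then obtain C K where "working_correlation M P T y X mu Sc b (\<lambda>i. Rs (i - 1) b) C K" using * by blast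
    then interpret wc: working_correlation M P T y X mu Sc b "\<lambda>i. Rs (i - 1) b" C K .
    show "\<forall>\<^sub>F n in sequentially. info_defined P (?g n) b"
      \<comment> \<open>Any value strictly between 0 and 1 would do in place of
        \<open>1 / 2\<close>, since only definedness is kept.\<close>
      using wc.eff_mat_working_ge[OF H g[OF b], of "1 / 2"] by (auto elim: eventually_mono)
  next
    fix q b l assume q: "\<forall>n\<ge>1. q n \<in> H_class M P T y X mu Sc n" and b: "b \<in> T"
      and def: "\<forall>\<^sub>F n in sequentially. info_defined P (q n) b" and l: "norm (l :: real^'p) = 1"
    obtain C K where "working_correlation M P T y X mu Sc b (\<lambda>i. Rs (i - 1) b) C K" using * b by blast
    then interpret wc: working_correlation M P T y X mu Sc b "\<lambda>i. Rs (i - 1) b" C K .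
    show "0 \<le> Liminf sequentially (\<lambda>n. ereal (l \<bullet> ((mat_inv_sqrt (info_mat P (?g n) b) **
        info_mat P (q n) b ** mat_inv_sqrt (info_mat P (?g n) b) - mat 1) *v l)))"
      using q by (intro wc.working_Liminf[OF H g[OF b] _ def l]) auto
  qed
qed

end
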